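(* Let $E_n=(\Omega_n,\mathcal{F}_n,\{Q_{1,n},\dots,Q_{d,n},Q_n\})$ with filtrations $(\mathcal{F}_{t,n})_{t\in I}$, $n\in\mathbb{N}$, be a sequence of financial experiments such that for all $i=1,\dots,d$ the sequences $(Q_{i,n})_n$ and $(Q_n)_n$ are mutually contiguous, i.e. $Q_{i,n}\triangleleft Q_n$ and $Q_n\triangleleft Q_{i,n}$. Then there exists a standard financial experiment $E=\big(([0,\infty)^d)^I,(\mathcal{B}([0,\infty)^d))^I,\{\nu_1,\dots,\nu_d,\nu\}\big)$, i.e. $\nu_1,\dots,\nu_d,\nu$ are probability measures with $\nu_i\ll\nu$ and $$\frac{d\nu_{i|\mathcal{G}_t}}{d\nu_{|\mathcal{G}_t}}=\pi^i_t,\qquad i=1,\dots,d,\ t\in I,$$ which is an accumulation point of the sequence $(E_n)$ in the following sense: there exists a subnet $(\mathcal{I},\le)$ of $(\mathbb{N},\le)$ such that for all $i=1,\dots,d+1$ all finite dimensional marginal distributions of $\big(\mathcal{L}(Y_{T,\tau}\,|\,Q_{i,\tau})\big)_{\tau\in\mathcal{I}}$ converge weakly to the corresponding marginals of $\nu_i$, where by convention $\nu_{d+1}=\nu$ and $Q_{d+1,n}=Q_n$.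
   Context: Fix $0<T<\infty$ and a set $I\subset[0,T]$ with $\{0,T\}\subset I$. Financial experiment (for each $n$): a probability space $(\Omega_n,\mathcal{F}_n,P_n)$ with filtration $(\mathcal{F}_{t,n})_{t\in I}$, $\mathcal{F}_n=\sigma(\mathcal{F}_{t,n}:t\in I)$, $\mathcal{F}_{0,n}=\sigma(\{N\in\mathcal{F}_n:P_n(N)=0\text{ or }1\})$; adapted (strictly) positive discounted price processes $(X^i_{t,n})_{t\in I}$, $1\le i\le d$; a probability measure $Q_n$ equivalent to $P_n$ under which all $(X^i_{t,n})_{t\in I}$ are martingales; and probability measures $Q_{i,n}$ with $\frac{dQ_{i,n}}{dQ_n}=\frac{X^i_{T,n}}{X^i_{0,n}}$, so that $\frac{dQ_{i,n|\mathcal{F}_{t,n}}}{dQ_{n|\mathcal{F}_{t,n}}}=\frac{X^i_{t,n}}{X^i_{0,n}}$ for all $t\in I$. Put $$Y_{T,n}=\left(\left(\frac{X^i_{s,n}}{X^i_{0,n}}\right)_{i=1,\dots,d}\right)_{s\in I}.$$ $\mathcal{L}(Y\,|\,Q)$ denotes the law of $Y$ under $Q$. Contiguity: $P_n\triangleleft Q_n$ (for probability measures on $(\Omega_n,\mathcal{F}_n)$) means that $Q_n(A_n)\to0$ implies $P_n(A_n)\to0$ for every sequence $A_n\in\mathcal{F}_n$. On $([0,\infty)^d)^I$, with product $\sigma$-field $(\mathcal{B}([0,\infty)^d))^I$, $\pi_t=(\pi^i_t)_{i\le d}$ is the canonical projection onto the coordinate $t\in I$ and $\mathcal{G}_t=\sigma(\pi_s:s\in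 I\cap[0,t])$. Subnet is in the sense of Kelley: a directed set $(\mathcal{I},\le)$ with a map $\tau\mapsto n(\tau)\in\mathbb{N}$ such that for each $m\in\mathbb{N}$ there is $\tau_0$ with $n(\tau)\ge m$ for all $\tau\ge\tau_0$; an index $\tau$ on an object stands for $n(\tau)$. Finite dimensional marginals are the image laws under projections to $([0,\infty)^d)^J$, $J\subset I$ finite. *)

theory Defs
  imports "HOL-Probability.Probability"
begin

section \<open>Financial experiments\<close>

text \<open>
  Time runs through an arbitrary set \<open>I\<close> of reals; the values of \<open>F\<close> and \<open>X\<close> at times outside
  \<open>I\<close> are irrelevant. Sub-sigma-fields are represented by measures \<open>F t\<close> of which only the
  measurable sets matter.
\<close>

definition martingale_on ::
    "'a measure \<Rightarrow> (real \<Rightarrow> 'a measure) \<Rightarrow> real set \<Rightarrow> (real \<Rightarrow> 'a \<Rightarrow> real) \<Rightarrow> bool" where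
  "martingale_on M F I X \<longleftrightarrow>
     (\<forall>t\<in>I. X t \<in> borel_measurable (F t) \<and> integrable M (X t)) \<and>
     (\<forall>s\<in>I. \<forall>t\<in>I. s \<le> t \<longrightarrow> (AE \<omega> in M. real_cond_exp M (F s) (X t) \<omega> = X s \<omega>))"

locale financial_experiment =
  fixes T :: real and I :: "real set"
    and P :: "'a measure" and F :: "real \<Rightarrow> 'a measure"
    and X :: "'d::finite \<Rightarrow> real \<Rightarrow> 'a \<Rightarrow> real"
    and Q :: "'a measure" and Qi :: "'d \<Rightarrow> 'a measure"
  assumes prob_space_P: "prob_space P"
    and subalgebra_F: "\<And>t. t \<in> I \<Longrightarrow> subalgebra P (F t)"
    and filtration_F: "\<And>s t. s \<in> I \<Longrightarrow> t \<in> I \<Longrightarrow> s \<le> t \<Longrightarrow> sets (F s) \<subseteq> sets (F t)"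
    and generated_F: "sets P = sigma_sets (space P) (\<Union>t\<in>I. sets (F t))"
    and trivial_F0:
      "sets (F 0) = sigma_sets (space P) {N \<in> sets P. measure P N = 0 \<or> measure P N = 1}"
    and adapted_X: "\<And>i t. t \<in> I \<Longrightarrow> X i t \<in> borel_measurable (F t)"
    and positive_X: "\<And>i t \<omega>. t \<in> I \<Longrightarrow> \<omega> \<in> space P \<Longrightarrow> 0 < X i t \<omega>"
    and prob_space_Q: "prob_space Q"
    and sets_Q: "sets Q = sets P"
    and equivalent_PQ: "absolutely_continuous P Q" "absolutely_continuous Q P"
    and martingale_X: "\<And>i. martingale_on Q F I (X i)"
    and prob_space_Qi: "\<And>i. prob_space (Qi i)"
    and density_Qi: "\<And>i. Qi i = density Q (\<lambda>\<omega>. ennreal (X i T \<omega> / X i 0 \<omega>))"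

definition contiguous :: "(nat \<Rightarrow> 'a measure) \<Rightarrow> (nat \<Rightarrow> 'a measure) \<Rightarrow> bool"
    (infix "\<lhd>" 50) where
  "P \<lhd> Q \<longleftrightarrow> (\<forall>A. (\<forall>n. A n \<in> sets (Q n)) \<longrightarrow>
     (\<lambda>n. measure (Q n) (A n)) \<longlonglongrightarrow> 0 \<longrightarrow> (\<lambda>n. measure (P n) (A n)) \<longlonglongrightarrow> 0)"

section \<open>The path space\<close>

definition nonneg_orthant :: "(real ^ 'd) set" where
  "nonneg_orthant = {x. \<forall>i. 0 \<le> x $ i}"

text \<open>
  The measurable space of all families indexed by \<open>J\<close> in the nonnegative orthant. As usual for
  \<^const>\<open>PiM\<close>, a family takes the value \<^const>\<open>undefined\<close> outside \<open>J\<close>, so the space carries no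
  coordinates besides those in \<open>J\<close>.
\<close>

definition path_space :: "real set \<Rightarrow> (real \<Rightarrow> real ^ 'd) measure" where
  "path_space J = PiM J (\<lambda>_. restrict_space borel nonneg_orthant)"

definition path_topology :: "real set \<Rightarrow> (real \<Rightarrow> real ^ 'd) topology" where
  "path_topology J = product_topology (\<lambda>_. top_of_set nonneg_orthant) J"

definition canonical_filtration :: "real set \<Rightarrow> real \<Rightarrow> (real \<Rightarrow> real ^ 'd) measure" where
  "canonical_filtration I t = sigma (space (path_space I))
     (\<Union>s\<in>I \<inter> {0..t}. {(\<lambda>\<omega>. \<omega> s) -` A \<inter> space (path_space I) |A.
        A \<in> sets (restrict_space borel nonneg_orthant)})"

definition standard_financial_experiment ::
    "real set \<Rightarrow> (real \<Rightarrow> real ^ 'd) measure \<Rightarrow> ('d \<Rightarrow> (real \<Rightarrow> real ^ 'd) measure) \<Rightarrow> bool" where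
  "standard_financial_experiment I \<nu> \<nu>i \<longleftrightarrow>
     prob_space \<nu> \<and> sets \<nu> = sets (path_space I) \<and>
     (\<forall>i. prob_space (\<nu>i i) \<and> sets (\<nu>i i) = sets (path_space I) \<and>
          absolutely_continuous \<nu> (\<nu>i i) \<and>
          (\<forall>t\<in>I. restr_to_subalg (\<nu>i i) (canonical_filtration I t) =
                  density (restr_to_subalg \<nu> (canonical_filtration I t)) (\<lambda>\<omega>. ennreal (\<omega> t $ i))))"

definition price_ratio_process ::
    "real set \<Rightarrow> ('d::finite \<Rightarrow> real \<Rightarrow> 'a \<Rightarrow> real) \<Rightarrow> 'a \<Rightarrow> real \<Rightarrow> real ^ 'd" where
  "price_ratio_process I X \<omega> = (\<lambda>s\<in>I. \<chi> i. X i s \<omega> / X i 0 \<omega>)"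

definition marginal :: "real set \<Rightarrow> (real \<Rightarrow> real ^ 'd) measure \<Rightarrow> (real \<Rightarrow> real ^ 'd) measure" where
  "marginal J \<mu> = distr \<mu> (path_space J) (\<lambda>\<omega>. restrict \<omega> J)"

section \<open>Subnets and weak convergence\<close>

definition directed_set :: "'i set \<Rightarrow> ('i \<Rightarrow> 'i \<Rightarrow> bool) \<Rightarrow> bool" where
  "directed_set D le \<longleftrightarrow> D \<noteq> {} \<and> (\<forall>x\<in>D. le x x) \<and>
     (\<forall>x\<in>D. \<forall>y\<in>D. \<forall>z\<in>D. le x y \<longrightarrow> le y z \<longrightarrow> le x z) \<and>
     (\<forall>x\<in>D. \<forall>y\<in>D. \<exists>z\<in>D. le x z \<and> le y z)"

definition subnet_of_nat :: "'i set \<Rightarrow> ('i \<Rightarrow> 'i \<Rightarrow> bool) \<Rightarrow> ('i \<Rightarrow> nat) \<Rightarrow> bool" where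
  "subnet_of_nat D le n \<longleftrightarrow> directed_set D le \<and> (\<forall>m. \<exists>t0\<in>D. \<forall>t\<in>D. le t0 t \<longrightarrow> m \<le> n t)"

definition net_filter :: "'i set \<Rightarrow> ('i \<Rightarrow> 'i \<Rightarrow> bool) \<Rightarrow> 'i filter" where
  "net_filter D le = (INF t0\<in>D. principal {t \<in> D. le t0 t})"

lemma eventually_net_filter:
  assumes "directed_set D le"
  shows "eventually R (net_filter D le) \<longleftrightarrow> (\<exists>t0\<in>D. \<forall>t\<in>D. le t0 t \<longrightarrow> R t)"
proof -
  have "eventually R (net_filter D le) \<longleftrightarrow>
      (\<exists>t0\<in>D. eventually R (principal {t \<in> D. le t0 t}))"
    unfolding net_filter_def
  proof (rule eventually_INF_base)
    show "D \<noteq> {}"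
      using assms by (simp add: directed_set_def)
    fix a b assume ab: "a \<in> D" "b \<in> D"
    then obtain c where c: "c \<in> D" "le a c" "le b c"
      using assms unfolding directed_set_def by blast
    have "{t \<in> D. le c t} \<subseteq> {t \<in> D. le a t} \<inter> {t \<in> D. le b t}"
      using assms ab c unfolding directed_set_def by blast
    then show "\<exists>x\<in>D. principal {t \<in> D. le x t} \<le>
        inf (principal {t \<in> D. le a t}) (principal {t \<in> D. le b t})"
      using c by (auto intro!: bexI[of _ c])
  qed
  then show ?thesis
    by (auto simp: eventually_principal)
qed

text \<open>
  HOL cannot quantify existentially over the type of indices of a net. Index sets inside
  \<^typ>\<open>nat set \<times> nat\<close> suffice: every subnet of the natural numbers, over whatever index type, has
  the same convergence behaviour (the same eventuality filter on the natural numbers) as one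
  indexed by pairs \<open>(A, k)\<close> with \<open>k \<in> A\<close>.
\<close>

lemma subnet_of_nat_canonical_index:
  fixes D :: "'i set" and n :: "'i \<Rightarrow> nat"
  assumes sub: "subnet_of_nat D le n"
  shows "\<exists>(D' :: (nat set \<times> nat) set) le' n'. subnet_of_nat D' le' n' \<and>
           filtermap n' (net_filter D' le') = filtermap n (net_filter D le)"
proof -
  have dir: "directed_set D le"
    using sub by (simp add: subnet_of_nat_def)
  define G where "G = filtermap n (net_filter D le)"
  have evG: "eventually R G \<longleftrightarrow> (\<exists>t0\<in>D. \<forall>t\<in>D. le t0 t \<longrightarrow> R (n t))" for R
    by (simp add: G_def eventually_filtermap eventually_net_filter[OF dir])
  have exG: "\<exists>k. R k" if "eventually R G" for R
    using that dir unfolding evG directed_set_def by blast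
  define D' where "D' = {(A, k). eventually (\<lambda>x. x \<in> A) G \<and> k \<in> A}"
  define le' where "le' = (\<lambda>(A, k :: nat) (B, l :: nat). B \<subseteq> (A :: nat set))"
  have dir': "directed_set D' le'"
    unfolding directed_set_def
  proof (intro conjI ballI impI)
    have "(UNIV, 0) \<in> D'"
      by (simp add: D'_def)
    then show "D' \<noteq> {}"
      by blast
    fix x y assume xy: "x \<in> D'" "y \<in> D'"
    then have ev: "eventually (\<lambda>k. k \<in> fst x \<inter> fst y) G"
      by (auto simp: D'_def intro: eventually_conj)
    then obtain k where "k \<in> fst x \<inter> fst y"
      using exG by blast
    with ev show "\<exists>z\<in>D'. le' x z \<and> le' y z"
      by (intro bexI[of _ "(fst x \<inter> fst y, k)"]) (auto simp: D'_def le'_def)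
  qed (auto simp: le'_def)
  have "filtermap snd (net_filter D' le') = G"
  proof (rule filter_eqI)
    fix R
    show "eventually R (filtermap snd (net_filter D' le')) \<longleftrightarrow> eventually R G"
      unfolding eventually_filtermap eventually_net_filter[OF dir']
    proof
      assume "\<exists>t0\<in>D'. \<forall>t\<in>D'. le' t0 t \<longrightarrow> R (snd t)"
      then obtain A k where "(A, k) \<in> D'" and R: "\<And>t. t \<in> D' \<Longrightarrow> le' (A, k) t \<Longrightarrow> R (snd t)"
        by auto
      then have A: "eventually (\<lambda>x. x \<in> A) G"
        by (simp add: D'_def)
      then have "R l" if "l \<in> A" for l
        using R[of "(A, l)"] that by (simp add: D'_def le'_def)
      with A show "eventually R G"
        by (auto elim: eventually_mono)
    next
      assume R: "eventually R G"
      then obtain k where "R k"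
        using exG by blast
      with R show "\<exists>t0\<in>D'. \<forall>t\<in>D'. le' t0 t \<longrightarrow> R (snd t)"
        by (intro bexI[of _ "(Collect R, k)"]) (auto simp: D'_def le'_def)
    qed
  qed
  moreover have "subnet_of_nat D' le' snd"
    unfolding subnet_of_nat_def
  proof (intro conjI dir' allI)
    fix m
    have ev: "eventually (\<lambda>x. x \<in> {m..}) G"
      using sub unfolding evG subnet_of_nat_def by simp
    then show "\<exists>t0\<in>D'. \<forall>t\<in>D'. le' t0 t \<longrightarrow> m \<le> snd t"
      by (intro bexI[of _ "({m..}, m)"]) (auto simp: D'_def le'_def)
  qed
  ultimately show ?thesis
    unfolding G_def by blast
qed

definition weakly_convergent ::
    "'s topology \<Rightarrow> ('i \<Rightarrow> 's measure) \<Rightarrow> 's measure \<Rightarrow> 'i filter \<Rightarrow> bool" where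
  "weakly_convergent S M N G \<longleftrightarrow>
     (\<forall>f. continuous_map S euclideanreal f \<and> bounded (f ` topspace S) \<longrightarrow>
        ((\<lambda>t. \<integral>x. f x \<partial>M t) \<longlongrightarrow> (\<integral>x. f x \<partial>N)) G)"

definition fidi_convergent ::
    "real set \<Rightarrow> ('i \<Rightarrow> (real \<Rightarrow> real ^ 'd) measure) \<Rightarrow> (real \<Rightarrow> real ^ 'd) measure \<Rightarrow>
     'i filter \<Rightarrow> bool" where
  "fidi_convergent I \<mu> \<nu> G \<longleftrightarrow>
     (\<forall>J. finite J \<and> J \<subseteq> I \<longrightarrow>
        weakly_convergent (path_topology J) (\<lambda>t. marginal J (\<mu> t)) (marginal J \<nu>) G)"

end

theory Submission
  imports Defs
begin

text \<open>
  The idea is to realise the limit experiment on one probability space, on which the paths of the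
  approximating experiments converge almost surely, and to obtain this space as an ultraproduct.

  Fix a free ultrafilter \<open>U\<close> on the natural numbers. Every sequence in a compact ordered set
  converges along \<open>U\<close>, and convergence along \<open>U\<close> is convergence along a subnet (\<open>ex_subnet\<close>).
  On sequences \<open>\<omega>\<close> of sample points consider the internal sets, those of the form
  \<open>{\<omega>. \<omega> n \<in> A n for U-almost all n}\<close>. The limit along \<open>U\<close> of the probabilities of \<open>A n\<close> is
  finitely additive on them, and countably additive because a decreasing sequence of nonempty
  internal sets has nonempty intersection (\<open>internal_saturation\<close>). Its extension is the Loeb
  measure (\<open>emeasure_internal\<close>). For uniformly bounded functions, the limit of the integrals is the
  integral of the pointwise limit (\<open>integral_tendsto\<close>).

  Let \<open>\<nu>\<close> and \<open>\<nu>i\<close> be the laws of the path of limiting price ratios under the Loeb measures of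
  \<open>Q\<close> and \<open>Qi\<close>. Two points remain. First, the price ratio at time \<open>t\<close> is the density of \<open>Qi\<close> with
  respect to \<open>Q\<close> on the sigma-field at time \<open>t\<close> (\<open>restr_to_subalg_Qi\<close>). Contiguity makes these
  densities uniformly integrable, so the limiting ratio is the density of the corresponding Loeb
  measures (\<open>loeb_density\<close>). Transported to the path space, this says that coordinate \<open>i\<close> at time
  \<open>t\<close> is the density of \<open>\<nu>i i\<close> with respect to \<open>\<nu>\<close> at time \<open>t\<close> (\<open>density_limit\<close>). Secondly, a density
  integrates to one, so the limiting ratios are almost everywhere finite under the Loeb measure of
  \<open>Q\<close>, and under those of \<open>Qi\<close> by absolute continuity. Thus the coordinates converge almost
  everywhere along \<open>U\<close>, and integrating bounded continuous functions gives weak convergence of the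
  finite dimensional marginals (\<open>fidi_convergent_loeb\<close>).
\<close>

section \<open>Free ultrafilters on the natural numbers\<close>

text \<open>
  The ultrafilter is encoded by the HOL filter of its eventually true properties. Containment in
  \<open>sequentially\<close> means that it is free; it also makes convergence along it an accumulation
  property of the sequence.
\<close>

locale free_ultrafilter =
  fixes U :: "nat filter"
  assumes proper: "U \<noteq> bot"
    and free: "U \<le> sequentially"
    and ultra: "eventually R U \<or> eventually (\<lambda>n. \<not> R n) U"

text \<open>
  By Zorn's lemma there is a minimal proper filter below \<open>sequentially\<close>: a chain of proper filters has
  a proper infimum because the infimum is directed. Minimality forces a decision on every property
  \<open>R\<close>, since the restriction to \<open>R\<close> is either improper or the filter itself.
\<close>

lemma ex_free_ultrafilter: "\<exists>U. free_ultrafilter U"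
proof -
  define S where "S = {F :: nat filter. F \<noteq> bot \<and> F \<le> sequentially}"
  have "\<exists>U\<in>S. \<forall>F\<in>S. F \<le> U \<longrightarrow> F = U"
  proof (rule predicate_Zorn[of S "\<lambda>F G. G \<le> F"])
    show "partial_order_on S (relation_of (\<lambda>F G. G \<le> F) S)"
      by (rule partial_order_on_relation_ofI) auto
    fix C assume "C \<in> Chains (relation_of (\<lambda>F G. G \<le> F) S)"
    then have CS: "C \<subseteq> S" and chain: "\<And>F G. F \<in> C \<Longrightarrow> G \<in> C \<Longrightarrow> F \<le> G \<or> G \<le> F"
      by (auto simp: Chains_def relation_of_def)
    show "\<exists>u\<in>S. \<forall>F\<in>C. u \<le> F"
    proof (cases "C = {}")
      case True
      then show ?thesis
        by (intro bexI[of _ sequentially]) (auto simp: S_def)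
    next
      case False
      have "eventually (\<lambda>_. False) (Inf C) \<longleftrightarrow> (\<exists>F\<in>C. eventually (\<lambda>_. False) F)"
        using False chain by (intro eventually_Inf_base) (metis inf.absorb1 inf.absorb2 order_refl)+
      then have "Inf C \<noteq> bot"
        using CS by (auto simp: S_def trivial_limit_def)
      moreover have "Inf C \<le> sequentially"
        using False CS by (auto simp: S_def intro: Inf_lower2)
      ultimately show ?thesis
        by (auto simp: S_def intro!: bexI[of _ "Inf C"] Inf_lower)
    qed
  qed
  then obtain U where "U \<in> S" and max: "\<And>F. F \<in> S \<Longrightarrow> F \<le> U \<Longrightarrow> F = U"
    by blast
  then have U: "U \<noteq> bot" "U \<le> sequentially"
    by (simp_all add: S_def)
  have min: "F = U" if "F \<noteq> bot" "F \<le> U" for F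
    using max[of F] that order.trans[OF that(2) U(2)] by (simp add: S_def)
  have "eventually R U \<or> eventually (\<lambda>n. \<not> R n) U" for R
  proof (cases "inf U (principal {n. R n}) = bot")
    case True
    then have "eventually (\<lambda>_. False) (inf U (principal {n. R n}))"
      by (simp only: eventually_bot)
    then show ?thesis
      by (simp add: eventually_inf_principal)
  next
    case False
    then have "inf U (principal {n. R n}) = U"
      by (rule min) simp
    moreover have "eventually R (inf U (principal {n. R n}))"
      by (simp add: eventually_inf_principal)
    ultimately show ?thesis
      by simp
  qed
  with U have "free_ultrafilter U"
    by unfold_locales
  then show ?thesis ..
qed

context free_ultrafilter
begin

lemma not_eventually_iff: "\<not> eventually R U \<longleftrightarrow> eventually (\<lambda>n. \<not> R n) U"
  using ultra[of R] eventually_happens'[OF proper eventually_conj[of R U "\<lambda>n. \<not> R n"]]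
  by blast

lemma eventually_disj_iff:
  "eventually (\<lambda>n. R n \<or> S n) U \<longleftrightarrow> eventually R U \<or> eventually S U"
proof -
  have "\<not> eventually (\<lambda>n. R n \<or> S n) U \<longleftrightarrow> \<not> eventually R U \<and> \<not> eventually S U"
    unfolding not_eventually_iff by (simp add: eventually_conj_iff)
  then show ?thesis by blast
qed

text \<open>
  In a complete linear order every sequence converges along an ultrafilter. The lower limit is a
  total function that names this limit, and therefore serves throughout as the standard part map.
\<close>

lemma tendsto_Liminf:
  fixes f :: "nat \<Rightarrow> 'b :: {complete_linorder, linorder_topology}"
  shows "(f \<longlongrightarrow> Liminf U f) U"
proof (rule Liminf_eq_Limsup[OF proper refl])
  have "Limsup U f \<le> Liminf U f"
    unfolding Limsup_le_iff
  proof (intro allI impI)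
    fix y assume y: "Liminf U f < y"
    show "eventually (\<lambda>n. f n < y) U"
    proof (rule ccontr)
      assume "\<not> eventually (\<lambda>n. f n < y) U"
      then have "eventually (\<lambda>n. y \<le> f n) U"
        by (simp add: not_eventually_iff not_less)
      then show False
        using Liminf_bounded y by (metis leD)
    qed
  qed
  then show "Limsup U f = Liminf U f"
    using Liminf_le_Limsup[OF proper, of f] by (rule antisym)
qed

lemma Liminf_eqI_tendsto:
  fixes f :: "nat \<Rightarrow> 'b :: {complete_linorder, linorder_topology}"
  shows "(f \<longlongrightarrow> l) U \<Longrightarrow> Liminf U f = l"
  by (rule lim_imp_Liminf[OF proper])

end

section \<open>Loeb spaces\<close>

text \<open>
  Points of the hyperspace are sequences of sample points. They are not identified when they agree
  along the ultrafilter: an internal set does not distinguish such sequences anyway, and the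
  product avoids a quotient type.
\<close>

definition hyperspace :: "(nat \<Rightarrow> 'a measure) \<Rightarrow> (nat \<Rightarrow> 'a) set" where
  "hyperspace M = {\<omega>. \<forall>n. \<omega> n \<in> space (M n)}"

definition internal ::
    "nat filter \<Rightarrow> (nat \<Rightarrow> 'a measure) \<Rightarrow> (nat \<Rightarrow> 'a set) \<Rightarrow> (nat \<Rightarrow> 'a) set" where
  "internal U M A = {\<omega> \<in> hyperspace M. eventually (\<lambda>n. \<omega> n \<in> A n) U}"

definition loeb :: "nat filter \<Rightarrow> (nat \<Rightarrow> 'a measure) \<Rightarrow> (nat \<Rightarrow> 'a) measure" where
  "loeb U M = extend_measure (hyperspace M) {A. \<forall>n. A n \<in> sets (M n)} (internal U M)
     (\<lambda>A. Liminf U (\<lambda>n. emeasure (M n) (A n)))"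

lemma space_loeb: "space (loeb U M) = hyperspace M"
  unfolding loeb_def by (rule space_extend_measure) (auto simp: internal_def)

lemma sets_loeb:
  "sets (loeb U M) = sigma_sets (hyperspace M) (internal U M ` {A. \<forall>n. A n \<in> sets (M n)})"
  unfolding loeb_def by (rule sets_extend_measure) (auto simp: internal_def)

lemma internal_in_sets: "(\<And>n. A n \<in> sets (M n)) \<Longrightarrow> internal U M A \<in> sets (loeb U M)"
  by (auto simp: sets_loeb)

locale loeb_space = free_ultrafilter U for U +
  fixes M :: "nat \<Rightarrow> 'a measure"
  assumes prob: "\<And>n. prob_space (M n)"
begin

lemma internal_space: "internal U M (\<lambda>n. space (M n)) = hyperspace M"
  by (auto simp: internal_def hyperspace_def)

lemma internal_empty: "internal U M (\<lambda>n. {}) = {}"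
  by (auto simp: internal_def eventually_False proper)

lemma internal_Int: "internal U M A \<inter> internal U M B = internal U M (\<lambda>n. A n \<inter> B n)"
  by (auto simp: internal_def eventually_conj_iff)

lemma internal_Un: "internal U M A \<union> internal U M B = internal U M (\<lambda>n. A n \<union> B n)"
  by (auto simp: internal_def eventually_disj_iff)

lemma internal_Diff: "internal U M A - internal U M B = internal U M (\<lambda>n. A n - B n)"
  unfolding internal_def
  by (auto simp: eventually_conj_iff simp flip: not_eventually_iff)

text \<open>
  The ultraproduct measure of an internal set is well defined because the set determines its
  components along the ultrafilter: otherwise choose a point in which they differ at each index.
\<close>

lemma internal_cong_iff:
  assumes "\<And>n. A n \<in> sets (M n)" "\<And>n. B n \<in> sets (M n)"
  shows "internal U M A = internal U M B \<longleftrightarrow> eventually (\<lambda>n. A n = B n) U"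
proof
  assume "eventually (\<lambda>n. A n = B n) U"
  then show "internal U M A = internal U M B"
    unfolding internal_def
    by (intro Collect_cong conj_cong refl eventually_cong) (auto elim: eventually_mono)
next
  assume eq: "internal U M A = internal U M B"
  show "eventually (\<lambda>n. A n = B n) U"
  proof (rule ccontr)
    assume "\<not> eventually (\<lambda>n. A n = B n) U"
    then have ev: "eventually (\<lambda>n. A n \<noteq> B n) U"
      by (simp add: not_eventually_iff)
    have "\<exists>x. x \<in> space (M n) \<and> (A n \<noteq> B n \<longrightarrow> x \<in> A n \<longleftrightarrow> x \<notin> B n)" for n
    proof (cases "A n = B n")
      case True
      then show ?thesis
        using prob_space.not_empty[OF prob, of n] by auto
    next
      case False
      then show ?thesis
        using sets.sets_into_space[OF assms(1), of n] sets.sets_into_space[OF assms(2), of n] by blast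
    qed
    then obtain w where w: "\<And>n. w n \<in> space (M n)" "\<And>n. A n \<noteq> B n \<Longrightarrow> w n \<in> A n \<longleftrightarrow> w n \<notin> B n"
      by metis
    have "eventually (\<lambda>n. w n \<in> A n) U \<longleftrightarrow> eventually (\<lambda>n. w n \<in> B n) U"
      using eq w(1) by (auto simp: internal_def hyperspace_def set_eq_iff)
    moreover have "eventually (\<lambda>n. w n \<in> A n) U \<longleftrightarrow> eventually (\<lambda>n. w n \<notin> B n) U"
      by (rule eventually_cong[OF ev]) (rule w(2))
    ultimately show False
      using not_eventually_iff by blast
  qed
qed

text \<open>
  Countable saturation. At index \<open>n\<close> pick a point of \<open>A 0 n, ..., A k n\<close> for the largest \<open>k \<le> n\<close>
  for which these sets have a common point. For a given \<open>k\<close> they have one at almost all indices, by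
  the hypothesis; at those beyond \<open>k\<close>, the point chosen lies in \<open>A k n\<close>.
\<close>

lemma internal_saturation:
  fixes A :: "nat \<Rightarrow> nat \<Rightarrow> 'a set"
  assumes A: "\<And>k n. A k n \<in> sets (M n)" and ne: "\<And>k. (\<Inter>j\<le>k. internal U M (A j)) \<noteq> {}"
  shows "(\<Inter>k. internal U M (A k)) \<noteq> {}"
proof -
  have ev: "eventually (\<lambda>n. (\<Inter>j\<le>k. A j n) \<noteq> {}) U" for k
  proof -
    obtain w where w: "\<And>j. j \<le> k \<Longrightarrow> w \<in> internal U M (A j)"
      using ne[of k] by auto
    have "eventually (\<lambda>n. \<forall>j\<in>{..k}. w n \<in> A j n) U"
      using w by (intro eventually_ball_finite) (auto simp: internal_def)
    then show ?thesis
      by eventually_elim auto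
  qed
  define K where "K n = (GREATEST k. k \<le> n \<and> (\<Inter>j\<le>k. A j n) \<noteq> {})" for n
  have "\<exists>x. x \<in> space (M n) \<and> (\<forall>k\<le>n. (\<Inter>j\<le>k. A j n) \<noteq> {} \<longrightarrow> x \<in> A k n)" for n
  proof (cases "\<exists>k\<le>n. (\<Inter>j\<le>k. A j n) \<noteq> {}")
    case True
    then have "K n \<le> n \<and> (\<Inter>j\<le>K n. A j n) \<noteq> {}"
      unfolding K_def by (rule GreatestI_ex_nat[where b = n]) simp
    then obtain x where x: "\<And>j. j \<le> K n \<Longrightarrow> x \<in> A j n"
      by auto
    have "k \<le> K n" if "k \<le> n" "(\<Inter>j\<le>k. A j n) \<noteq> {}" for k
      unfolding K_def using that by (intro Greatest_le_nat[where b = n]) auto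
    then show ?thesis
      using x x[of 0] sets.sets_into_space[OF A, of 0 n] by auto
  next
    case False
    then show ?thesis
      using prob_space.not_empty[OF prob, of n] by auto
  qed
  then obtain w where w: "\<And>n. w n \<in> space (M n)"
      "\<And>n k. k \<le> n \<Longrightarrow> (\<Inter>j\<le>k. A j n) \<noteq> {} \<Longrightarrow> w n \<in> A k n"
    by metis
  have "w \<in> internal U M (A k)" for k
  proof -
    have "eventually (\<lambda>n. k \<le> n) U"
      using free eventually_ge_at_top filter_leD by blast
    with ev[of k] have "eventually (\<lambda>n. w n \<in> A k n) U"
      by eventually_elim (rule w(2))
    then show ?thesis
      using w(1) by (auto simp: internal_def hyperspace_def)
  qed
  then show ?thesis
    by blast
qed

text \<open>
  Taking limits along the ultrafilter gives a finitely additive function on the algebra of internal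
  sets. By saturation, a decreasing sequence of internal sets with empty intersection is eventually
  empty. Continuity at the empty set is thus trivial, and Caratheodory's theorem applies.
\<close>

lemma emeasure_internal:
  assumes A: "\<And>n. A n \<in> sets (M n)"
  shows "emeasure (loeb U M) (internal U M A) = Liminf U (\<lambda>n. emeasure (M n) (A n))"
proof -
  define G where "G = {A :: nat \<Rightarrow> 'a set. \<forall>n. A n \<in> sets (M n)}"
  define m where "m A = Liminf U (\<lambda>n. emeasure (M n) (A n))" for A
  define f where "f B = m (SOME A. A \<in> G \<and> B = internal U M A)" for B
  have f: "f (internal U M A) = m A" if "A \<in> G" for A
  proof -
    define A' where "A' = (SOME A'. A' \<in> G \<and> internal U M A = internal U M A')"
    have "A' \<in> G \<and> internal U M A = internal U M A'"
      unfolding A'_def by (rule someI[of _ A]) (use that in auto)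
    then have "eventually (\<lambda>n. A n = A' n) U"
      using that internal_cong_iff unfolding G_def by blast
    then have "m A = m A'"
      unfolding m_def by (intro Liminf_eq) (auto elim: eventually_mono)
    then show ?thesis
      by (simp add: f_def A'_def)
  qed
  interpret algebra "hyperspace M" "internal U M ` G"
    unfolding algebra_iff_Un
  proof (intro conjI ballI)
    show "internal U M ` G \<subseteq> Pow (hyperspace M)"
      by (auto simp: internal_def)
    show "{} \<in> internal U M ` G"
      using internal_empty by (auto simp: G_def image_iff intro!: exI[of _ "\<lambda>_. {}"])
    show "hyperspace M - a \<in> internal U M ` G" if "a \<in> internal U M ` G" for a
    proof -
      from that obtain A where "a = internal U M A" "A \<in> G" by auto
      then show ?thesis
        unfolding internal_space[symmetric]
        by (auto simp: internal_Diff G_def intro!: image_eqI[where x = "\<lambda>n. space (M n) - A n"])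
    qed
    show "a \<union> b \<in> internal U M ` G" if "a \<in> internal U M ` G" "b \<in> internal U M ` G" for a b
    proof -
      from that obtain A B where "a = internal U M A" "A \<in> G" "b = internal U M B" "B \<in> G" by auto
      then show ?thesis
        by (auto simp: internal_Un G_def intro!: image_eqI[where x = "\<lambda>n. A n \<union> B n"])
    qed
  qed
  have "\<exists>\<mu>. (\<forall>s\<in>internal U M ` G. \<mu> s = f s) \<and>
      measure_space (hyperspace M) (sigma_sets (hyperspace M) (internal U M ` G)) \<mu>"
  proof (rule caratheodory_empty_continuous)
    have 0: "(\<lambda>n. {}) \<in> G" by (simp add: G_def)
    have "m (\<lambda>n. {}) = 0"
      by (simp add: m_def Liminf_const proper)
    then show "positive (internal U M ` G) f"
      using f[OF 0] by (simp add: positive_def internal_empty)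
    show "additive (internal U M ` G) f"
      unfolding additive_def
    proof (intro ballI impI)
      fix x y assume "x \<in> internal U M ` G" "y \<in> internal U M ` G" and disj: "x \<inter> y = {}"
      then obtain A B where AB: "x = internal U M A" "A \<in> G" "y = internal U M B" "B \<in> G" by auto
      have "internal U M (\<lambda>n. A n \<inter> B n) = internal U M (\<lambda>n. {})"
        using disj AB by (simp add: internal_Int internal_empty)
      then have ev: "eventually (\<lambda>n. A n \<inter> B n = {}) U"
        using AB by (subst (asm) internal_cong_iff) (auto simp: G_def)
      have "((\<lambda>n. emeasure (M n) (A n) + emeasure (M n) (B n)) \<longlongrightarrow> m A + m B) U"
        unfolding m_def by (intro tendsto_add tendsto_Liminf)
      moreover have "eventually (\<lambda>n. emeasure (M n) (A n) + emeasure (M n) (B n) =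
          emeasure (M n) (A n \<union> B n)) U"
        using ev by eventually_elim (use AB in \<open>auto simp: G_def intro!: plus_emeasure\<close>)
      ultimately have "((\<lambda>n. emeasure (M n) (A n \<union> B n)) \<longlongrightarrow> m A + m B) U"
        by (rule Lim_transform_eventually)
      then have "m (\<lambda>n. A n \<union> B n) = m A + m B"
        unfolding m_def by (rule Liminf_eqI_tendsto)
      moreover have "(\<lambda>n. A n \<union> B n) \<in> G"
        using AB by (auto simp: G_def)
      ultimately show "f (x \<union> y) = f x + f y"
        using f AB by (simp add: internal_Un)
    qed
    have m_le: "m A \<le> 1" for A
      unfolding m_def using prob_space.measure_le_1[OF prob]
      by (intro Liminf_le) (auto simp: proper)
    show "f A \<noteq> \<infinity>" if "A \<in> internal U M ` G" for A
    proof -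
      have "f A \<le> 1"
        unfolding f_def by (rule m_le)
      then show ?thesis
        by (auto simp: top_unique)
    qed
    fix B assume B: "range B \<subseteq> internal U M ` G" "decseq B" "(\<Inter>i. B i) = {}"
    then have "\<forall>i. \<exists>A\<in>G. B i = internal U M A"
      by blast
    then obtain A where A: "\<And>i. A i \<in> G" "\<And>i. B i = internal U M (A i)"
      by metis
    obtain k where "(\<Inter>j\<le>k. B j) = {}"
      using internal_saturation[of A] A B(3) by (auto simp: G_def)
    moreover have "B k \<subseteq> (\<Inter>j\<le>k. B j)"
      using B(2) by (auto simp: decseq_def)
    ultimately have "B i = {}" if "i \<ge> k" for i
      using that B(2) unfolding decseq_def by blast
    then have "eventually (\<lambda>i. f (B i) = 0) sequentially"
      using f[OF 0] \<open>m (\<lambda>n. {}) = 0\<close>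
      by (auto simp: eventually_sequentially internal_empty intro!: exI[of _ k])
    then show "(\<lambda>i. f (B i)) \<longlonglongrightarrow> 0"
      by (rule tendsto_eventually)
  qed
  then obtain \<mu> where \<mu>: "\<And>s. s \<in> internal U M ` G \<Longrightarrow> \<mu> s = f s"
    "measure_space (hyperspace M) (sigma_sets (hyperspace M) (internal U M ` G)) \<mu>"
    by blast
  have "emeasure (loeb U M) (internal U M A) = m A"
  proof (rule emeasure_extend_measure[where \<mu>' = \<mu> and I = G and \<Omega> = "hyperspace M"])
    show "loeb U M = extend_measure (hyperspace M) G (internal U M) m"
      by (simp add: loeb_def G_def m_def[abs_def])
    show "\<mu> (internal U M i) = m i" if "i \<in> G" for i
      using \<mu>(1) f that by simp
    show "internal U M ` G \<subseteq> Pow (hyperspace M)"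
      by (auto simp: internal_def)
    show "positive (sets (loeb U M)) \<mu>" "countably_additive (sets (loeb U M)) \<mu>"
      using \<mu>(2) by (auto simp: sets_loeb G_def measure_space_def)
    show "A \<in> G"
      using A by (simp add: G_def)
  qed
  then show ?thesis
    by (simp add: m_def)
qed

lemma emeasure_internal_tendsto:
  assumes "\<And>n. A n \<in> sets (M n)"
  shows "((\<lambda>n. emeasure (M n) (A n)) \<longlongrightarrow> emeasure (loeb U M) (internal U M A)) U"
  unfolding emeasure_internal[OF assms] by (rule tendsto_Liminf)

sublocale prob_space "loeb U M"
proof
  have "emeasure (loeb U M) (internal U M (\<lambda>n. space (M n))) = 1"
    by (simp add: emeasure_internal prob_space.emeasure_space_1[OF prob] Liminf_const proper)
  then show "emeasure (loeb U M) (space (loeb U M)) = 1"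
    by (simp add: space_loeb internal_space)
qed

lemma measure_internal_tendsto:
  assumes "\<And>n. A n \<in> sets (M n)"
  shows "((\<lambda>n. measure (M n) (A n)) \<longlongrightarrow> measure (loeb U M) (internal U M A)) U"
  unfolding measure_def
  by (rule tendsto_enn2real)
     (use emeasure_internal_tendsto[OF assms] in \<open>simp_all add: emeasure_eq_measure\<close>)

lemma Int_stable_internal: "Int_stable (internal U M ` {A. \<forall>n. A n \<in> sets (M n)})"
proof (rule Int_stableI_image)
  fix A B assume "A \<in> {A. \<forall>n. A n \<in> sets (M n)}" "B \<in> {A. \<forall>n. A n \<in> sets (M n)}"
  then show "\<exists>C\<in>{A. \<forall>n. A n \<in> sets (M n)}. internal U M A \<inter> internal U M B = internal U M C"
    by (intro bexI[of _ "\<lambda>n. A n \<inter> B n"]) (auto simp: internal_Int)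
qed

text \<open>
  Internal sets are stable under intersection, so they determine a measure on the Loeb space.
\<close>

lemma loeb_eqI:
  assumes "sets N = sets (loeb U M)"
    and "\<And>A. (\<And>n. A n \<in> sets (M n)) \<Longrightarrow>
      emeasure N (internal U M A) = emeasure (loeb U M) (internal U M A)"
  shows "N = loeb U M"
proof (rule measure_eqI_generator_eq[OF Int_stable_internal, where \<Omega> = "hyperspace M" and A = "\<lambda>_. hyperspace M"])
  show "range (\<lambda>_. hyperspace M) \<subseteq> internal U M ` {A. \<forall>n. A n \<in> sets (M n)}"
    using internal_space by (auto simp: image_iff intro!: exI[of _ "\<lambda>n. space (M n)"])
  show "emeasure N (hyperspace M) \<noteq> \<infinity>"
    using assms(2)[of "\<lambda>n. space (M n)"] by (simp add: internal_space)
qed (use assms in \<open>auto simp: sets_loeb internal_def\<close>)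

text \<open>
  A standard part exceeds \<open>y\<close> iff, for some \<open>q > y\<close> from a countable dense set, almost all
  components exceed \<open>q\<close>; the latter event is internal.
\<close>

lemma borel_measurable_Liminf_internal:
  fixes g :: "nat \<Rightarrow> 'a \<Rightarrow> ennreal"
  assumes [measurable]: "\<And>n. g n \<in> borel_measurable (M n)"
  shows "(\<lambda>\<omega>. Liminf U (\<lambda>n. g n (\<omega> n))) \<in> borel_measurable (loeb U M)"
proof (rule borel_measurableI_greater)
  fix y :: ennreal
  obtain D :: "ennreal set" where D: "countable D" "\<And>X. open X \<Longrightarrow> X \<noteq> {} \<Longrightarrow> \<exists>d\<in>D. d \<in> X"
    by (erule countable_dense_setE)
  define A where "A q n = {x \<in> space (M n). q < g n x}" for q n
  have [measurable]: "A q n \<in> sets (M n)" for q n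
    unfolding A_def by measurable
  have "{\<omega> \<in> space (loeb U M). y < Liminf U (\<lambda>n. g n (\<omega> n))} =
      (\<Union>q\<in>D \<inter> {y<..}. internal U M (A q))"
  proof (intro set_eqI iffI)
    fix \<omega> assume \<omega>: "\<omega> \<in> {\<omega> \<in> space (loeb U M). y < Liminf U (\<lambda>n. g n (\<omega> n))}"
    let ?l = "Liminf U (\<lambda>n. g n (\<omega> n))"
    have "{y<..<?l} \<noteq> {}"
      using \<omega> dense by auto
    then obtain q where q: "q \<in> D" "y < q" "q < ?l"
      using D(2)[of "{y<..<?l}"] by auto
    have "eventually (\<lambda>n. q < g n (\<omega> n)) U"
      by (rule less_LiminfD[OF q(3)])
    then show "\<omega> \<in> (\<Union>q\<in>D \<inter> {y<..}. internal U M (A q))"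
      using \<omega> q by (auto simp: internal_def A_def space_loeb hyperspace_def intro!: bexI[of _ q])
  next
    fix \<omega> assume "\<omega> \<in> (\<Union>q\<in>D \<inter> {y<..}. internal U M (A q))"
    then obtain q where q: "y < q" "\<omega> \<in> internal U M (A q)" by auto
    then have "q \<le> Liminf U (\<lambda>n. g n (\<omega> n))"
      by (intro Liminf_bounded) (auto simp: internal_def A_def elim: eventually_mono)
    with q show "\<omega> \<in> {\<omega> \<in> space (loeb U M). y < Liminf U (\<lambda>n. g n (\<omega> n))}"
      by (auto simp: internal_def space_loeb)
  qed
  also have "\<dots> \<in> sets (loeb U M)"
    using D(1) by (intro sets.countable_UN' image_subsetI internal_in_sets) auto
  finally show "{\<omega> \<in> space (loeb U M). y < Liminf U (\<lambda>n. g n (\<omega> n))} \<in> sets (loeb U M)" .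
qed

end

section \<open>Integrals on Loeb spaces\<close>

text \<open>
  The sum counts the \<open>j\<close> with \<open>1 \<le> j \<le> k x\<close>, of which there are \<open>\<lfloor>k x\<rfloor>\<close>: a function with
  values in the unit interval is within \<open>1/k\<close> of a combination of the indicators of \<open>k\<close> level sets.
\<close>

lemma sum_levels_near:
  fixes x :: real and k :: nat
  assumes "0 < k" "0 \<le> x" "x \<le> 1"
  shows "\<bar>x - (\<Sum>j=1..k. of_bool (real j \<le> real k * x)) / real k\<bar> \<le> 1 / real k"
proof -
  have kx: "0 \<le> real k * x" "real k * x \<le> real k"
    using assms by (auto intro: mult_left_le)
  have "{j \<in> {1..k}. real j \<le> real k * x} = {1..nat \<lfloor>real k * x\<rfloor>}"
    using kx by (auto simp: le_nat_floor le_floor_iff le_nat_iff)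
  then have "(\<Sum>j=1..k. of_bool (real j \<le> real k * x)) = (real (nat \<lfloor>real k * x\<rfloor>) :: real)"
    by (simp add: of_bool_def sum.If_cases Int_def)
  also have "\<dots> = of_int \<lfloor>real k * x\<rfloor>"
    using kx by simp
  finally have eq: "(\<Sum>j=1..k. of_bool (real j \<le> real k * x)) = (of_int \<lfloor>real k * x\<rfloor> :: real)" .
  have "\<bar>real k * x - of_int \<lfloor>real k * x\<rfloor>\<bar> \<le> 1"
    by linarith
  then have "\<bar>real k * x - of_int \<lfloor>real k * x\<rfloor>\<bar> / real k \<le> 1 / real k"
    by (intro divide_right_mono) auto
  also have "\<bar>real k * x - of_int \<lfloor>real k * x\<rfloor>\<bar> / real k = \<bar>(real k * x - of_int \<lfloor>real k * x\<rfloor>) / real k\<bar>"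
    by simp
  also have "(real k * x - of_int \<lfloor>real k * x\<rfloor>) / real k = x - of_int \<lfloor>real k * x\<rfloor> / real k"
    using assms(1) by (simp add: diff_divide_distrib)
  finally show ?thesis
    unfolding eq .
qed

lemma (in prob_space) expectation_near_level_sets:
  fixes g :: "'a \<Rightarrow> real"
  assumes g: "integrable M g" and B[measurable]: "\<And>j. B j \<in> events"
    and near: "AE x in M. \<bar>g x - (\<Sum>j=1..k. indicator (B j) x) / real k\<bar> \<le> 1 / real k"
  shows "\<bar>expectation g - (\<Sum>j=1..k. prob (B j)) / real k\<bar> \<le> 1 / real k"
proof -
  define S where "S x = (\<Sum>j=1..k. indicator (B j) x) / real k" for x
  have S: "integrable M S"
    unfolding S_def by (intro integrable_divide_zero integrable_sum integrable_real_indicator) (auto simp: emeasure_eq_measure)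
  have "expectation S = (\<Sum>j=1..k. prob (B j)) / real k"
    unfolding S_def by (subst integral_divide_zero, subst Bochner_Integration.integral_sum)
      (auto simp: emeasure_eq_measure)
  then have "\<bar>expectation g - (\<Sum>j=1..k. prob (B j)) / real k\<bar> = \<bar>expectation (\<lambda>x. g x - S x)\<bar>"
    using g S by simp
  also have "\<dots> \<le> expectation (\<lambda>x. \<bar>g x - S x\<bar>)"
    by (rule integral_abs_bound)
  also have "\<dots> \<le> expectation (\<lambda>x. 1 / real k)"
    using near[folded S_def] g S by (intro integral_mono_AE integrable_abs Bochner_Integration.integrable_diff) auto
  finally show ?thesis
    by (simp add: prob_space)
qed

context loeb_space
begin

lemma indicator_internal_tendsto:
  assumes "\<omega> \<in> hyperspace M"
  shows "((\<lambda>n. indicator (A n) (\<omega> n) :: real) \<longlongrightarrow> indicator (internal U M A) \<omega>) U"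
proof (rule tendsto_eventually, cases "\<omega> \<in> internal U M A")
  case True
  then have "eventually (\<lambda>n. \<omega> n \<in> A n) U"
    by (simp add: internal_def)
  then show "eventually (\<lambda>n. indicator (A n) (\<omega> n) = indicator (internal U M A) \<omega>) U"
    by eventually_elim (use True in simp)
next
  case False
  then have "eventually (\<lambda>n. \<omega> n \<notin> A n) U"
    using assms by (simp add: internal_def not_eventually_iff)
  then show "eventually (\<lambda>n. indicator (A n) (\<omega> n) = indicator (internal U M A) \<omega>) U"
    by eventually_elim (use False in simp)
qed

text \<open>
  Up to an error \<open>1/k\<close>, uniform in the index, both integrals are sums of measures of \<open>k\<close> level sets.
  The level sets of the \<open>g n\<close> form internal sets, whose Loeb measures are by definition the limits of
  the measures of the components.
\<close>

lemma integral_tendsto_unit: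
  fixes g :: "nat \<Rightarrow> 'a \<Rightarrow> real"
  assumes g[measurable]: "\<And>n. g n \<in> borel_measurable (M n)"
    and bnd: "\<And>n x. x \<in> space (M n) \<Longrightarrow> 0 \<le> g n x \<and> g n x \<le> 1"
    and h[measurable]: "h \<in> borel_measurable (loeb U M)"
    and lim: "AE \<omega> in loeb U M. ((\<lambda>n. g n (\<omega> n)) \<longlongrightarrow> h \<omega>) U"
  shows "((\<lambda>n. \<integral>x. g n x \<partial>M n) \<longlongrightarrow> (\<integral>\<omega>. h \<omega> \<partial>loeb U M)) U"
proof (rule tendstoI)
  fix e :: real assume e: "e > 0"
  then obtain k' where k': "1 / real (Suc k') < e / 3"
    by (metis nat_approx_posE divide_pos_pos zero_less_numeral)
  define k where "k = Suc k'"
  have k: "0 < k" "1 / real k < e / 3"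
    using k' by (simp_all add: k_def)
  define A where "A j n = {x \<in> space (M n). real j \<le> real k * g n x}" for j n
  have [measurable]: "A j n \<in> sets (M n)" for j n
    unfolding A_def by measurable
  have near: "\<bar>g n x - (\<Sum>j=1..k. indicator (A j n) x) / real k\<bar> \<le> 1 / real k"
    if "x \<in> space (M n)" for n x
    using sum_levels_near[OF k(1), of "g n x"] bnd[OF that] that
    by (simp add: A_def indicator_def of_bool_def)
  \<comment> \<open>The bound only serves to make \<open>h\<close> integrable.\<close>
  have hb: "AE \<omega> in loeb U M. \<bar>h \<omega>\<bar> \<le> 1"
    using lim AE_space
  proof eventually_elim
    case (elim \<omega>)
    have "((\<lambda>n. \<bar>g n (\<omega> n)\<bar>) \<longlongrightarrow> \<bar>h \<omega>\<bar>) U"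
      using elim(1) by (rule tendsto_rabs)
    then show ?case
      by (rule tendsto_upperbound[OF _ always_eventually proper])
         (use elim(2) bnd in \<open>auto simp: space_loeb hyperspace_def\<close>)
  qed
  have "AE \<omega> in loeb U M. \<bar>h \<omega> - (\<Sum>j=1..k. indicator (internal U M (A j)) \<omega>) / real k\<bar> \<le> 1 / real k"
    using lim AE_space
  proof eventually_elim
    case (elim \<omega>)
    then have \<omega>: "\<omega> \<in> hyperspace M"
      by (simp add: space_loeb)
    have "((\<lambda>n. \<bar>g n (\<omega> n) - (\<Sum>j=1..k. indicator (A j n) (\<omega> n)) / real k\<bar>) \<longlongrightarrow>
       \<bar>h \<omega> - (\<Sum>j=1..k. indicator (internal U M (A j)) \<omega>) / real k\<bar>) U"
      by (intro tendsto_rabs tendsto_diff tendsto_divide tendsto_sum tendsto_const elim(1)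
          indicator_internal_tendsto \<omega>) (use k in auto)
    then show ?case
      by (rule tendsto_upperbound[OF _ always_eventually proper])
         (use \<omega> near in \<open>auto simp: hyperspace_def\<close>)
  qed
  then have 1: "\<bar>expectation h - (\<Sum>j=1..k. prob (internal U M (A j))) / real k\<bar> \<le> 1 / real k"
    using hb by (intro expectation_near_level_sets internal_in_sets integrable_const_bound[where B = 1]) auto
  have 2: "\<bar>(\<integral>x. g n x \<partial>M n) - (\<Sum>j=1..k. measure (M n) (A j n)) / real k\<bar> \<le> 1 / real k" for n
  proof -
    interpret N: prob_space "M n" by (rule prob)
    show ?thesis
      using bnd near by (intro N.expectation_near_level_sets N.integrable_const_bound[where B = 1]) auto
  qed
  have "((\<lambda>n. (\<Sum>j=1..k. measure (M n) (A j n)) / real k) \<longlongrightarrow>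
      (\<Sum>j=1..k. prob (internal U M (A j))) / real k) U"
    by (intro tendsto_divide tendsto_sum measure_internal_tendsto tendsto_const) (use k in auto)
  then have "eventually (\<lambda>n. dist ((\<Sum>j=1..k. measure (M n) (A j n)) / real k)
      ((\<Sum>j=1..k. prob (internal U M (A j))) / real k) < e / 3) U"
    using e by (intro tendstoD) auto
  then show "eventually (\<lambda>n. dist (\<integral>x. g n x \<partial>M n) (\<integral>\<omega>. h \<omega> \<partial>loeb U M) < e) U"
  proof eventually_elim
    case (elim n)
    with 1 2[of n] k(2) show ?case
      unfolding dist_real_def by linarith
  qed
qed

text \<open>
  Integrals of uniformly bounded functions pass to the limit; an affine change of the values reduces
  this to the unit interval. It is the source of the weak convergence of laws and, after truncation,
  of the formula for densities.
\<close>

theorem integral_tendsto: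
  fixes g :: "nat \<Rightarrow> 'a \<Rightarrow> real"
  assumes g[measurable]: "\<And>n. g n \<in> borel_measurable (M n)"
    and bnd: "\<And>n x. x \<in> space (M n) \<Longrightarrow> \<bar>g n x\<bar> \<le> C"
    and h[measurable]: "h \<in> borel_measurable (loeb U M)"
    and lim: "AE \<omega> in loeb U M. ((\<lambda>n. g n (\<omega> n)) \<longlongrightarrow> h \<omega>) U"
  shows "((\<lambda>n. \<integral>x. g n x \<partial>M n) \<longlongrightarrow> (\<integral>\<omega>. h \<omega> \<partial>loeb U M)) U"
proof -
  \<comment> \<open>A strictly positive bound, because the values are rescaled by \<open>2 * D\<close> below.\<close>
  define D where "D = \<bar>C\<bar> + 1"
  have bnd': "\<bar>g n x\<bar> \<le> D" if "x \<in> space (M n)" for n x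
    using bnd[OF that] by (simp add: D_def)
  have D0: "D > 0" by (simp add: D_def)
  have hb: "AE \<omega> in loeb U M. \<bar>h \<omega>\<bar> \<le> D"
    using lim AE_space
  proof eventually_elim
    case (elim \<omega>)
    have "((\<lambda>n. \<bar>g n (\<omega> n)\<bar>) \<longlongrightarrow> \<bar>h \<omega>\<bar>) U"
      using elim(1) by (rule tendsto_rabs)
    then show ?case
      by (rule tendsto_upperbound[OF _ always_eventually proper])
         (use elim(2) bnd' in \<open>auto simp: space_loeb hyperspace_def\<close>)
  qed
  have "((\<lambda>n. \<integral>x. (g n x + D) / (2 * D) \<partial>M n) \<longlongrightarrow> (\<integral>\<omega>. (h \<omega> + D) / (2 * D) \<partial>loeb U M)) U"
  proof (rule integral_tendsto_unit)
    show "0 \<le> (g n x + D) / (2 * D) \<and> (g n x + D) / (2 * D) \<le> 1" if "x \<in> space (M n)" for n x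
      using bnd'[OF that] D0 by (auto simp: field_simps)
    show "AE \<omega> in loeb U M. ((\<lambda>n. (g n (\<omega> n) + D) / (2 * D)) \<longlongrightarrow> (h \<omega> + D) / (2 * D)) U"
      using lim by eventually_elim (intro tendsto_intros, use D0 in auto)
  qed measurable
  then have "((\<lambda>n. 2 * D * (\<integral>x. (g n x + D) / (2 * D) \<partial>M n) - D) \<longlongrightarrow>
      2 * D * (\<integral>\<omega>. (h \<omega> + D) / (2 * D) \<partial>loeb U M) - D) U"
    by (intro tendsto_intros)
  moreover have "2 * D * (\<integral>x. (g n x + D) / (2 * D) \<partial>M n) - D = (\<integral>x. g n x \<partial>M n)" for n
  proof -
    interpret N: prob_space "M n" by (rule prob)
    have "integrable (M n) (g n)"
      using bnd' by (intro N.integrable_const_bound[where B = D]) auto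
    then show ?thesis
      using D0 by (simp add: N.prob_space)
  qed
  moreover have "2 * D * (\<integral>\<omega>. (h \<omega> + D) / (2 * D) \<partial>loeb U M) - D = (\<integral>\<omega>. h \<omega> \<partial>loeb U M)"
  proof -
    have "integrable (loeb U M) h"
      using hb by (intro integrable_const_bound[where B = D]) auto
    then show ?thesis
      using D0 by (simp add: prob_space)
  qed
  ultimately show ?thesis
    by simp
qed

lemma nn_integral_tendsto:
  fixes g :: "nat \<Rightarrow> 'a \<Rightarrow> real"
  assumes g[measurable]: "\<And>n. g n \<in> borel_measurable (M n)"
    and bnd: "\<And>n x. x \<in> space (M n) \<Longrightarrow> 0 \<le> g n x \<and> g n x \<le> C"
  shows "((\<lambda>n. \<integral>\<^sup>+x. ennreal (g n x) \<partial>M n) \<longlongrightarrow>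
    (\<integral>\<^sup>+\<omega>. Liminf U (\<lambda>n. ennreal (g n (\<omega> n))) \<partial>loeb U M)) U"
proof -
  define h where "h \<omega> = Liminf U (\<lambda>n. ennreal (g n (\<omega> n)))" for \<omega>
  have [measurable]: "h \<in> borel_measurable (loeb U M)"
    unfolding h_def by (rule borel_measurable_Liminf_internal) measurable
  have hC: "h \<omega> \<le> ennreal C" if "\<omega> \<in> hyperspace M" for \<omega>
    unfolding h_def using that bnd
    by (intro Liminf_le proper always_eventually) (auto simp: hyperspace_def intro: ennreal_leI)
  then have h_real: "h \<omega> = ennreal (enn2real (h \<omega>))" if "\<omega> \<in> hyperspace M" for \<omega>
    using that by (metis ennreal_enn2real ennreal_less_top le_less_trans)
  have lim: "((\<lambda>n. g n (\<omega> n)) \<longlongrightarrow> enn2real (h \<omega>)) U" if \<omega>: "\<omega> \<in> hyperspace M" for \<omega>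
  proof -
    have "((\<lambda>n. ennreal (g n (\<omega> n))) \<longlongrightarrow> ennreal (enn2real (h \<omega>))) U"
      using tendsto_Liminf[of "\<lambda>n. ennreal (g n (\<omega> n))"] h_real[OF \<omega>] by (simp add: h_def)
    then show ?thesis
      using \<omega> bnd by (subst (asm) tendsto_ennreal_iff) (auto simp: hyperspace_def)
  qed
  have "((\<lambda>n. \<integral>x. g n x \<partial>M n) \<longlongrightarrow> (\<integral>\<omega>. enn2real (h \<omega>) \<partial>loeb U M)) U"
    using lim bnd by (intro integral_tendsto[where C = C]) (auto simp: space_loeb)
  then have "((\<lambda>n. ennreal (\<integral>x. g n x \<partial>M n)) \<longlongrightarrow> ennreal (\<integral>\<omega>. enn2real (h \<omega>) \<partial>loeb U M)) U"
    by (rule tendsto_ennrealI)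
  moreover have "ennreal (\<integral>x. g n x \<partial>M n) = (\<integral>\<^sup>+x. ennreal (g n x) \<partial>M n)" for n
  proof -
    interpret N: prob_space "M n" by (rule prob)
    show ?thesis
      using bnd by (intro nn_integral_eq_integral[symmetric] N.integrable_const_bound[where B = C]) auto
  qed
  moreover have "ennreal (\<integral>\<omega>. enn2real (h \<omega>) \<partial>loeb U M) = (\<integral>\<^sup>+\<omega>. ennreal (enn2real (h \<omega>)) \<partial>loeb U M)"
  proof (intro nn_integral_eq_integral[symmetric] integrable_const_bound[where B = "enn2real (ennreal C)"])
    show "AE \<omega> in loeb U M. norm (enn2real (h \<omega>)) \<le> enn2real (ennreal C)"
      using hC by (auto simp: space_loeb enn2real_mono)
  qed auto
  moreover have "(\<integral>\<^sup>+\<omega>. ennreal (enn2real (h \<omega>)) \<partial>loeb U M) = (\<integral>\<^sup>+\<omega>. h \<omega> \<partial>loeb U M)"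
    using h_real by (intro nn_integral_cong) (simp add: space_loeb)
  ultimately show ?thesis
    by (simp add: h_def)
qed

end

section \<open>Densities and contiguity\<close>

text \<open>
  Contiguity is a statement about sequences of sets; this is its uniform form. If it fails for some
  \<open>e\<close>, there are sets at a strictly increasing sequence of indices whose \<open>M\<close>-measures tend to zero
  while their \<open>N\<close>-measures stay above \<open>e\<close>. Filling the other indices with the empty set gives a
  sequence that contradicts contiguity.
\<close>

lemma contiguous_uniform:
  assumes cont: "N \<lhd> M" and sets: "\<And>n. sets (N n) = sets (M n)" and e: "0 < e"
  shows "\<exists>d>0. \<forall>\<^sub>F n in sequentially. \<forall>A\<in>sets (M n). measure (M n) A < d \<longrightarrow> measure (N n) A < e"
proof (rule ccontr)
  define bad where "bad d n A \<longleftrightarrow> A \<in> sets (M n) \<and> measure (M n) A < d \<and> e \<le> measure (N n) A" for d n A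
  assume "\<not> ?thesis"
  then have bad: "\<exists>n\<ge>m. \<exists>A. bad d n A" if "0 < d" for d m
    using that unfolding bad_def eventually_sequentially by (metis not_le)
  have "\<exists>r. \<forall>k. (\<exists>A. bad (1 / Suc k) (r k) A) \<and> r k < r (Suc k)"
  proof (rule dependent_nat_choice)
    show "\<exists>n. \<exists>A. bad (1 / Suc 0) n A"
      using bad[of "1 / Suc 0" 0] by auto
    show "\<exists>n'. (\<exists>A. bad (1 / Suc (Suc k)) n' A) \<and> n < n'" for n k
      using bad[of "1 / Suc (Suc k)" "Suc n"] by (auto simp: Suc_le_eq)
  qed
  then obtain r B where r: "strict_mono r" and B: "\<And>k. bad (1 / Suc k) (r k) (B k)"
    unfolding strict_mono_Suc_iff by metis
  define A where "A n = (if n \<in> range r then B (the_inv r n) else {})" for n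
  have A_r: "A (r k) = B k" for k
    using strict_mono_imp_inj_on[OF r] by (simp add: A_def the_inv_f_f)
  have "A n \<in> sets (M n)" for n
  proof (cases "n \<in> range r")
    case True
    then obtain k where "n = r k" by auto
    then show ?thesis
      using B[of k] by (simp add: bad_def A_r)
  qed (simp add: A_def)
  moreover have "(\<lambda>n. measure (M n) (A n)) \<longlonglongrightarrow> 0"
  proof (rule LIMSEQ_I)
    fix c :: real assume "0 < c"
    then obtain k0 where k0: "1 / Suc k0 < c"
      by (rule nat_approx_posE)
    have "norm (measure (M n) (A n) - 0) < c" if n: "n \<ge> r k0" for n
    proof (cases "n \<in> range r")
      case True
      then obtain k where k: "n = r k" by auto
      then have "k0 \<le> k"
        using n r by (simp add: strict_mono_less_eq)
      then have "1 / real (Suc k) \<le> 1 / real (Suc k0)"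
        by (simp add: frac_le)
      then show ?thesis
        using B[of k] k0 by (simp add: k A_r bad_def)
    next
      case False
      then show ?thesis
        using \<open>0 < c\<close> by (simp add: A_def)
    qed
    then show "\<exists>n0. \<forall>n\<ge>n0. norm (measure (M n) (A n) - 0) < c"
      by blast
  qed
  ultimately have "(\<lambda>n. measure (N n) (A n)) \<longlonglongrightarrow> 0"
    using cont unfolding contiguous_def by blast
  then have "(\<lambda>k. measure (N (r k)) (B k)) \<longlonglongrightarrow> 0"
    using LIMSEQ_subseq_LIMSEQ[OF _ r] by (fastforce simp: o_def A_r)
  then have "e \<le> 0"
    by (rule LIMSEQ_le_const) (use B in \<open>auto simp: bad_def\<close>)
  then show False
    using e by simp
qed

lemma ennreal_SUP_min_of_nat: "(SUP k::nat. min x (of_nat k)) = (x :: ennreal)"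
proof -
  have "(SUP k::nat. min x (of_nat k)) = inf x (SUP k::nat. of_nat k)"
    by (simp add: inf_SUP flip: inf_min)
  then show ?thesis
    by (simp add: ennreal_SUP_of_nat_eq_top)
qed

context loeb_space
begin

text \<open>
  Contiguity makes the densities uniformly integrable, so that their standard part \<open>h\<close> loses no
  mass. It suffices to compare the two measures on an internal set with components \<open>A n\<close>. The integrals \<open>I k\<close> of the truncations \<open>min h k\<close> over this set are limits of
  integrals \<open>J k n\<close> of truncated densities, which bounds them by the measure of the set. Conversely,
  truncating at \<open>k\<close> costs at most the \<open>N n\<close>-measure of \<open>{f n > k}\<close>. By Markov's inequality the
  \<open>M n\<close>-measure of this event is at most \<open>1/k\<close>, and contiguity turns this into a small
  \<open>N n\<close>-measure, uniformly for late \<open>n\<close>.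
\<close>

theorem loeb_density:
  fixes f :: "nat \<Rightarrow> 'a \<Rightarrow> real"
  assumes f[measurable]: "\<And>n. f n \<in> borel_measurable (M n)"
    and nonneg: "\<And>n x. x \<in> space (M n) \<Longrightarrow> 0 \<le> f n x"
    and N: "\<And>n. N n = density (M n) (\<lambda>x. ennreal (f n x))"
    and prob_N: "\<And>n. prob_space (N n)"
    and cont: "N \<lhd> M"
  shows "loeb U N = density (loeb U M) (\<lambda>\<omega>. Liminf U (\<lambda>n. ennreal (f n (\<omega> n))))"
proof -
  interpret N: loeb_space U N
    by (intro loeb_space.intro free_ultrafilter_axioms loeb_space_axioms.intro prob_N)
  have sets_N[measurable_cong]: "sets (N n) = sets (M n)" for n
    by (simp add: N)
  have space_N: "space (N n) = space (M n)" for n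
    by (simp add: N)
  have hyper_N: "hyperspace N = hyperspace M"
    by (simp add: hyperspace_def space_N)
  have int_N: "internal U N = internal U M"
    by (simp add: internal_def hyper_N fun_eq_iff)
  have sets_loeb_N: "sets (loeb U N) = sets (loeb U M)"
    by (simp add: sets_loeb hyper_N int_N sets_N)
  define h where "h \<omega> = Liminf U (\<lambda>n. ennreal (f n (\<omega> n)))" for \<omega>
  have h[measurable]: "h \<in> borel_measurable (loeb U M)"
    unfolding h_def by (rule borel_measurable_Liminf_internal) measurable
  have "density (loeb U M) h = loeb U N"
  proof (rule N.loeb_eqI)
    show "sets (density (loeb U M) h) = sets (loeb U N)"
      by (simp add: sets_loeb_N)
    fix A assume "\<And>n. A n \<in> sets (N n)"
    then have A[measurable]: "A n \<in> sets (M n)" for n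
      by (simp add: sets_N)
    have [measurable]: "internal U M A \<in> sets (loeb U M)"
      by (rule internal_in_sets) measurable
    define I where "I k = (\<integral>\<^sup>+\<omega>. min (h \<omega>) (of_nat k) * indicator (internal U M A) \<omega> \<partial>loeb U M)" for k :: nat
    define J where "J k n = (\<integral>\<^sup>+x. ennreal (min (f n x) (real k) * indicator (A n) x) \<partial>M n)" for k n
    have J_I: "(J k \<longlongrightarrow> I k) U" for k
    proof -
      have "Liminf U (\<lambda>n. ennreal (min (f n (\<omega> n)) (real k) * indicator (A n) (\<omega> n))) =
          min (h \<omega>) (of_nat k) * indicator (internal U M A) \<omega>" if \<omega>: "\<omega> \<in> hyperspace M" for \<omega>
      proof (rule Liminf_eqI_tendsto, cases "\<omega> \<in> internal U M A")
        case True
        then have ev: "eventually (\<lambda>n. \<omega> n \<in> A n) U"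
          by (simp add: internal_def)
        have "((\<lambda>n. min (ennreal (f n (\<omega> n))) (of_nat k)) \<longlongrightarrow> min (h \<omega>) (of_nat k)) U"
          unfolding h_def by (intro tendsto_min tendsto_Liminf tendsto_const)
        moreover have "eventually (\<lambda>n. min (ennreal (f n (\<omega> n))) (of_nat k) =
            ennreal (min (f n (\<omega> n)) (real k) * indicator (A n) (\<omega> n))) U"
          using ev
        proof eventually_elim
          case (elim n)
          have "0 \<le> f n (\<omega> n)"
            using nonneg \<omega> by (auto simp: hyperspace_def)
          then show ?case
            using elim by (simp add: min_def ennreal_of_nat_eq_real_of_nat)
        qed
        ultimately have "((\<lambda>n. ennreal (min (f n (\<omega> n)) (real k) * indicator (A n) (\<omega> n))) \<longlongrightarrow> min (h \<omega>) (of_nat k)) U"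
          by (rule Lim_transform_eventually)
        then show "((\<lambda>n. ennreal (min (f n (\<omega> n)) (real k) * indicator (A n) (\<omega> n))) \<longlongrightarrow>
            min (h \<omega>) (of_nat k) * indicator (internal U M A) \<omega>) U"
          using True by simp
      next
        case False
        then have ev: "eventually (\<lambda>n. \<omega> n \<notin> A n) U"
          using \<omega> by (simp add: internal_def not_eventually_iff)
        show "((\<lambda>n. ennreal (min (f n (\<omega> n)) (real k) * indicator (A n) (\<omega> n))) \<longlongrightarrow>
            min (h \<omega>) (of_nat k) * indicator (internal U M A) \<omega>) U"
          by (rule tendsto_eventually, use ev in eventually_elim) (use False in simp)
      qed
      then have "I k = (\<integral>\<^sup>+\<omega>. Liminf U (\<lambda>n. ennreal (min (f n (\<omega> n)) (real k) * indicator (A n) (\<omega> n))) \<partial>loeb U M)"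
        unfolding I_def by (intro nn_integral_cong) (simp add: space_loeb)
      moreover have "(J k \<longlongrightarrow> (\<integral>\<^sup>+\<omega>. Liminf U (\<lambda>n. ennreal (min (f n (\<omega> n)) (real k) * indicator (A n) (\<omega> n))) \<partial>loeb U M)) U"
        unfolding J_def using nonneg
        by (intro nn_integral_tendsto[where C = k]) (auto simp: indicator_def)
      ultimately show ?thesis
        by (simp only:)
    qed
    have N_A: "emeasure (N n) B = (\<integral>\<^sup>+x. ennreal (f n x) * indicator B x \<partial>M n)" if "B \<in> sets (M n)" for n B
      using that by (simp add: N emeasure_density)
    have lim_N: "((\<lambda>n. emeasure (N n) (A n)) \<longlongrightarrow> emeasure (loeb U N) (internal U M A)) U"
      using N.emeasure_internal_tendsto[of A] A by (simp add: int_N sets_N)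
    have upper: "I k \<le> emeasure (loeb U N) (internal U M A)" for k
    proof (rule tendsto_le[OF proper lim_N J_I always_eventually, rule_format])
      show "J k n \<le> emeasure (N n) (A n)" for n
        unfolding J_def N_A[OF A] using nonneg
        by (intro nn_integral_mono) (auto simp: indicator_def intro: ennreal_leI)
    qed
    have lower: "emeasure (loeb U N) (internal U M A) \<le> (SUP k. I k)"
    proof (rule ennreal_le_epsilon)
      fix e :: real assume e: "0 < e"
      obtain d where d: "d > 0"
        and ev: "\<forall>\<^sub>F n in sequentially. \<forall>A\<in>sets (M n). measure (M n) A < d \<longrightarrow> measure (N n) A < e"
        using contiguous_uniform[OF cont sets_N e] by blast
      obtain k' where k': "1 / real (Suc k') < d"
        using d by (rule nat_approx_posE)
      define k where "k = Suc k'"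
      have k: "0 < k" "1 / real k < d"
        using k' by (simp_all add: k_def)
      define B where "B n = {x \<in> space (M n). real k < f n x}" for n
      have [measurable]: "B n \<in> sets (M n)" for n
        unfolding B_def by measurable
      have "measure (M n) (B n) < d" for n
      proof -
        interpret Mn: prob_space "M n" by (rule prob)
        interpret Nn: prob_space "N n" by (rule prob_N)
        have "ennreal (real k * measure (M n) (B n)) = ennreal (real k) * emeasure (M n) (B n)"
          by (simp add: Mn.emeasure_eq_measure ennreal_mult)
        also have "\<dots> = (\<integral>\<^sup>+x. ennreal (real k) * indicator (B n) x \<partial>M n)"
          by (simp add: nn_integral_cmult_indicator)
        also have "\<dots> \<le> (\<integral>\<^sup>+x. ennreal (f n x) * indicator (B n) x \<partial>M n)"
          by (intro nn_integral_mono) (auto simp: B_def indicator_def intro: ennreal_leI)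
        also have "\<dots> = emeasure (N n) (B n)"
          by (simp add: N_A)
        also have "\<dots> \<le> ennreal 1"
          using Nn.measure_le_1 by simp
        finally have "real k * measure (M n) (B n) \<le> 1"
          by (subst (asm) ennreal_le_iff) auto
        then have "measure (M n) (B n) \<le> 1 / real k"
          using k by (simp add: field_simps)
        with k show ?thesis by simp
      qed
      then have "eventually (\<lambda>n. measure (N n) (B n) < e) sequentially"
        using ev by (auto elim: eventually_mono)
      then have "eventually (\<lambda>n. measure (N n) (B n) < e) U"
        using free filter_leD by blast
      then have "eventually (\<lambda>n. emeasure (N n) (A n) \<le> J k n + ennreal e) U"
      proof eventually_elim
        case (elim n)
        interpret Nn: prob_space "N n" by (rule prob_N)
        have "emeasure (N n) (A n) \<le>
          (\<integral>\<^sup>+x. ennreal (min (f n x) (real k) * indicator (A n) x) + ennreal (f n x) * indicator (B n) x \<partial>M n)"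
          unfolding N_A[OF A] using nonneg
          by (intro nn_integral_mono) (auto simp: indicator_def B_def min_def)
        also have "\<dots> = J k n + emeasure (N n) (B n)"
          unfolding J_def by (simp add: nn_integral_add N_A)
        also have "\<dots> \<le> J k n + ennreal e"
          using elim by (intro add_left_mono) (simp add: Nn.emeasure_eq_measure ennreal_leI)
        finally show ?case .
      qed
      then have "emeasure (loeb U N) (internal U M A) \<le> I k + ennreal e"
        by (intro tendsto_le[OF proper tendsto_add[OF J_I tendsto_const] lim_N])
      also have "\<dots> \<le> (SUP k. I k) + ennreal e"
        by (intro add_right_mono SUP_upper) simp
      finally show "emeasure (loeb U N) (internal U M A) \<le> (SUP k. I k) + ennreal e" .
    qed
    have "emeasure (density (loeb U M) h) (internal U M A) =
        (\<integral>\<^sup>+\<omega>. (SUP k::nat. min (h \<omega>) (of_nat k) * indicator (internal U M A) \<omega>) \<partial>loeb U M)"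
      by (subst SUP_mult_right_ennreal[symmetric]) (simp add: emeasure_density ennreal_SUP_min_of_nat)
    also have "\<dots> = (SUP k. I k)"
      unfolding I_def
      by (rule nn_integral_monotone_convergence_SUP)
         (auto simp: incseq_def le_fun_def intro!: mult_right_mono min.mono)
    also have "\<dots> = emeasure (loeb U N) (internal U M A)"
      using upper lower by (intro antisym SUP_least)
    finally show "emeasure (density (loeb U M) h) (internal U N A) = emeasure (loeb U N) (internal U N A)"
      by (simp add: int_N)
  qed
  then show ?thesis
    by (simp add: h_def[abs_def])
qed

text \<open>
  The standard part of the densities integrates to one, the total mass of the Loeb measure of
  \<open>N\<close>, and is therefore almost everywhere finite. So the values of the densities converge almost
  everywhere as real numbers, which is the tightness of their laws.
\<close>

corollary AE_tendsto_density:
  fixes f :: "nat \<Rightarrow> 'a \<Rightarrow> real"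
  assumes f[measurable]: "\<And>n. f n \<in> borel_measurable (M n)"
    and nonneg: "\<And>n x. x \<in> space (M n) \<Longrightarrow> 0 \<le> f n x"
    and N: "\<And>n. N n = density (M n) (\<lambda>x. ennreal (f n x))"
    and prob_N: "\<And>n. prob_space (N n)"
    and cont: "N \<lhd> M"
  shows "AE \<omega> in loeb U M. Liminf U (\<lambda>n. ennreal (f n (\<omega> n))) \<noteq> \<infinity> \<and>
    ((\<lambda>n. f n (\<omega> n)) \<longlongrightarrow> enn2real (Liminf U (\<lambda>n. ennreal (f n (\<omega> n))))) U"
proof -
  interpret N: loeb_space U N
    by (intro loeb_space.intro free_ultrafilter_axioms loeb_space_axioms.intro prob_N)
  define h where "h \<omega> = Liminf U (\<lambda>n. ennreal (f n (\<omega> n)))" for \<omega>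
  have h[measurable]: "h \<in> borel_measurable (loeb U M)"
    unfolding h_def by (rule borel_measurable_Liminf_internal) measurable
  have N_h: "loeb U N = density (loeb U M) h"
    using loeb_density[OF assms] by (simp add: h_def[abs_def])
  have "(\<integral>\<^sup>+\<omega>. h \<omega> \<partial>loeb U M) = emeasure (density (loeb U M) h) (space (loeb U M))"
    by (simp add: emeasure_density cong: nn_integral_cong)
  also have "\<dots> = emeasure (loeb U N) (space (loeb U N))"
    by (simp add: N_h)
  also have "\<dots> = 1"
    by (rule N.emeasure_space_1)
  finally have "AE \<omega> in loeb U M. h \<omega> \<noteq> \<infinity>"
    by (intro nn_integral_PInf_AE) auto
  then show ?thesis
    using AE_space
  proof eventually_elim
    case (elim \<omega>)
    then have "ennreal (enn2real (h \<omega>)) = h \<omega>"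
      by (simp add: less_top)
    then have "((\<lambda>n. ennreal (f n (\<omega> n))) \<longlongrightarrow> ennreal (enn2real (h \<omega>))) U"
      using tendsto_Liminf[of "\<lambda>n. ennreal (f n (\<omega> n))"] by (simp add: h_def)
    then have "((\<lambda>n. f n (\<omega> n)) \<longlongrightarrow> enn2real (h \<omega>)) U"
      using elim(2) nonneg by (subst (asm) tendsto_ennreal_iff) (auto simp: space_loeb hyperspace_def)
    with elim(1) show ?case
      by (simp add: h_def)
  qed
qed

lemma subalgebra_loeb:
  assumes sub: "\<And>n. subalgebra (M n) (F n)"
  shows "subalgebra (loeb U M) (loeb U (\<lambda>n. restr_to_subalg (M n) (F n)))"
proof -
  have "hyperspace (\<lambda>n. restr_to_subalg (M n) (F n)) = hyperspace M"
    by (simp add: hyperspace_def space_restr_to_subalg)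
  moreover have "internal U (\<lambda>n. restr_to_subalg (M n) (F n)) = internal U M"
    using calculation by (simp add: internal_def fun_eq_iff)
  moreover have "internal U M ` {A. \<forall>n. A n \<in> sets (F n)} \<subseteq> internal U M ` {A. \<forall>n. A n \<in> sets (M n)}"
    using sub by (intro image_mono) (auto simp: subalgebra_def)
  ultimately show ?thesis
    unfolding subalgebra_def sets_loeb space_loeb sets_restr_to_subalg[OF sub]
    by (simp add: sigma_sets_mono')
qed

text \<open>
  Passing to the Loeb space commutes with restriction to sub-sigma-fields. This lifts a filtration
  to the Loeb space and permits working at one time point.
\<close>

lemma restr_to_subalg_loeb:
  assumes sub: "\<And>n. subalgebra (M n) (F n)"
  shows "restr_to_subalg (loeb U M) (loeb U (\<lambda>n. restr_to_subalg (M n) (F n))) =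
    loeb U (\<lambda>n. restr_to_subalg (M n) (F n))"
proof -
  let ?MF = "\<lambda>n. restr_to_subalg (M n) (F n)"
  interpret MF: loeb_space U ?MF
    by (intro loeb_space.intro free_ultrafilter_axioms loeb_space_axioms.intro
        prob_space_restr_to_subalg sub prob)
  have hyper: "hyperspace ?MF = hyperspace M"
    by (simp add: hyperspace_def space_restr_to_subalg)
  have int: "internal U ?MF = internal U M"
    by (simp add: internal_def hyper fun_eq_iff)
  show ?thesis
  proof (rule MF.loeb_eqI)
    show "sets (restr_to_subalg (loeb U M) (loeb U ?MF)) = sets (loeb U ?MF)"
      by (rule sets_restr_to_subalg[OF subalgebra_loeb[OF sub]])
    fix A assume A: "\<And>n. A n \<in> sets (?MF n)"
    then have AF: "A n \<in> sets (F n)" and AM: "A n \<in> sets (M n)" for n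
      using sub[of n] A[of n] by (auto simp: sets_restr_to_subalg[OF sub] subalgebra_def)
    have "emeasure (restr_to_subalg (loeb U M) (loeb U ?MF)) (internal U ?MF A) =
        emeasure (loeb U M) (internal U ?MF A)"
      by (rule emeasure_restr_to_subalg[OF subalgebra_loeb[OF sub] internal_in_sets[OF A]])
    also have "\<dots> = emeasure (loeb U ?MF) (internal U ?MF A)"
      unfolding MF.emeasure_internal[OF A] unfolding int
      by (simp add: emeasure_internal[OF AM] emeasure_restr_to_subalg[OF sub AF])
    finally show "emeasure (restr_to_subalg (loeb U M) (loeb U ?MF)) (internal U ?MF A) =
      emeasure (loeb U ?MF) (internal U ?MF A)" .
  qed
qed

end

section \<open>Restriction to sub-sigma-fields\<close>

lemma contiguous_restr_to_subalg:
  assumes cont: "N \<lhd> M"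
    and sub: "\<And>n. subalgebra (M n) (F n)" "\<And>n. subalgebra (N n) (F n)"
  shows "(\<lambda>n. restr_to_subalg (N n) (F n)) \<lhd> (\<lambda>n. restr_to_subalg (M n) (F n))"
  unfolding contiguous_def sets_restr_to_subalg[OF sub(1)]
proof (intro allI impI)
  fix A assume A: "\<forall>n. A n \<in> sets (F n)"
    and lim: "(\<lambda>n. measure (restr_to_subalg (M n) (F n)) (A n)) \<longlonglongrightarrow> 0"
  have "\<forall>n. A n \<in> sets (M n)"
    using A sub(1) by (auto simp: subalgebra_def)
  moreover have "(\<lambda>n. measure (M n) (A n)) \<longlonglongrightarrow> 0"
    using lim A by (simp add: measure_def emeasure_restr_to_subalg[OF sub(1)])
  ultimately have "(\<lambda>n. measure (N n) (A n)) \<longlonglongrightarrow> 0"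
    using cont unfolding contiguous_def by blast
  then show "(\<lambda>n. measure (restr_to_subalg (N n) (F n)) (A n)) \<longlonglongrightarrow> 0"
    using A by (simp add: measure_def emeasure_restr_to_subalg[OF sub(2)])
qed

lemma restr_to_subalg_distr:
  assumes G: "subalgebra N G" and L: "subalgebra M L"
    and Y: "Y \<in> measurable M N" and Y': "Y \<in> measurable L G"
  shows "restr_to_subalg (distr M N Y) G = distr (restr_to_subalg M L) G Y"
proof (rule measure_eqI)
  have G': "subalgebra (distr M N Y) G"
    using G by (simp add: subalgebra_def)
  have Y'': "Y \<in> measurable (restr_to_subalg M L) G"
    using L Y' by (rule measurable_in_subalg)
  show "sets (restr_to_subalg (distr M N Y) G) = sets (distr (restr_to_subalg M L) G Y)"
    by (simp add: sets_restr_to_subalg[OF G'])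
  fix A assume "A \<in> sets (restr_to_subalg (distr M N Y) G)"
  then have A: "A \<in> sets G" "A \<in> sets N"
    using G by (auto simp: sets_restr_to_subalg[OF G'] subalgebra_def)
  have "Y -` A \<inter> space M \<in> sets L"
    using measurable_sets[OF Y' A(1)] L by (simp add: subalgebra_def)
  then show "emeasure (restr_to_subalg (distr M N Y) G) A = emeasure (distr (restr_to_subalg M L) G Y) A"
    by (simp add: emeasure_restr_to_subalg[OF G' A(1)] emeasure_distr[OF Y A(2)]
        emeasure_distr[OF Y'' A(1)] emeasure_restr_to_subalg[OF L] space_restr_to_subalg)
qed

lemma (in financial_experiment) subalgebra_Q:
  assumes "t \<in> I" shows "subalgebra Q (F t)"
  using subalgebra_F[OF assms] sets_Q sets_eq_imp_space_eq[OF sets_Q] by (simp add: subalgebra_def)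

lemma (in financial_experiment) space_eq: "space Q = space P" "space (Qi i) = space P" "sets (Qi i) = sets P"
  using sets_Q sets_eq_imp_space_eq[OF sets_Q] by (simp_all add: density_Qi)

lemma (in financial_experiment) subalgebra_Qi:
  assumes "t \<in> I" shows "subalgebra (Qi i) (F t)"
  using subalgebra_F[OF assms] by (simp add: subalgebra_def space_eq)

lemma (in financial_experiment) ratio_measurable:
  assumes "0 \<in> I" "t \<in> I" "0 \<le> t"
  shows "(\<lambda>\<omega>. X i t \<omega> / X i 0 \<omega>) \<in> borel_measurable (F t)"
proof -
  have "subalgebra (F t) (F 0)"
    using filtration_F[OF assms] subalgebra_F[OF assms(1)] subalgebra_F[OF assms(2)]
    by (simp add: subalgebra_def)
  then have "X i 0 \<in> borel_measurable (F t)"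
    using adapted_X[OF assms(1)] by (rule measurable_from_subalg)
  then show ?thesis
    using adapted_X[OF assms(2)] by (intro borel_measurable_divide)
qed

text \<open>
  The ratio at time \<open>t\<close> is the density on \<open>F t\<close>. Indeed \<open>1 / X i 0\<close> is known at time \<open>t\<close> and can
  be taken out of the conditional expectation of \<open>X i T / X i 0\<close>, which the martingale property then
  evaluates. This ratio is integrable as the density of a probability measure.
\<close>

lemma (in financial_experiment) restr_to_subalg_Qi:
  assumes I: "I \<subseteq> {0..T}" "{0, T} \<subseteq> I" and t: "t \<in> I"
  shows "restr_to_subalg (Qi i) (F t) =
    density (restr_to_subalg Q (F t)) (\<lambda>\<omega>. ennreal (X i t \<omega> / X i 0 \<omega>))"
proof -
  interpret Q: prob_space Q by (rule prob_space_Q)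
  have sub: "subalgebra Q (F t)"
    by (rule subalgebra_Q[OF t])
  interpret Ft: finite_measure_subalgebra Q "F t"
    by unfold_locales (rule sub)
  have 0: "0 \<in> I" "0 \<le> t" "T \<in> I" "t \<le> T"
    using I t by auto
  define Z where "Z s \<omega> = X i s \<omega> / X i 0 \<omega>" for s \<omega>
  have Zt[measurable]: "Z t \<in> borel_measurable (F t)"
    unfolding Z_def by (rule ratio_measurable) (use 0 t in auto)
  have X0[measurable]: "X i 0 \<in> borel_measurable (F t)"
    using measurable_from_subalg[of "F t" "F 0"] adapted_X[OF 0(1)] filtration_F[OF 0(1) t 0(2)]
      subalgebra_F[OF 0(1)] subalgebra_F[OF t] by (auto simp: subalgebra_def)
  have XT: "X i T \<in> borel_measurable Q"
    using measurable_from_subalg[OF subalgebra_Q[OF 0(3)] adapted_X[OF 0(3)]] .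
  have ZT[measurable]: "Z T \<in> borel_measurable Q"
    unfolding Z_def using XT measurable_from_subalg[OF sub X0] by (intro borel_measurable_divide)
  have ZtQ[measurable]: "Z t \<in> borel_measurable Q"
    by (rule measurable_from_subalg[OF sub Zt])
  have Z_nonneg: "0 \<le> Z s \<omega>" if "\<omega> \<in> space Q" "s \<in> I" for s \<omega>
    using positive_X[of s \<omega> i] positive_X[of 0 \<omega> i] that 0 by (simp add: Z_def space_eq)
  have Qi_eq: "Qi i = density Q (\<lambda>\<omega>. ennreal (Z T \<omega>))"
    by (simp add: density_Qi Z_def)
  have "(\<integral>\<^sup>+\<omega>. ennreal (Z T \<omega>) \<partial>Q) = emeasure (Qi i) (space Q)"
    unfolding Qi_eq by (simp add: emeasure_density cong: nn_integral_cong)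
  also have "\<dots> = 1"
    using prob_space.emeasure_space_1[OF prob_space_Qi] by (simp add: space_eq)
  finally have int_ZT: "integrable Q (Z T)"
    using Z_nonneg 0 by (intro integrableI_nonneg) auto
  have "AE \<omega> in Q. real_cond_exp Q (F t) (\<lambda>\<omega>. 1 / X i 0 \<omega> * X i T \<omega>) \<omega> =
      1 / X i 0 \<omega> * real_cond_exp Q (F t) (X i T) \<omega>"
    using int_ZT XT by (intro Ft.real_cond_exp_mult) (auto simp: Z_def[abs_def])
  moreover have "AE \<omega> in Q. real_cond_exp Q (F t) (X i T) \<omega> = X i t \<omega>"
    using martingale_X[of i] t 0 unfolding martingale_on_def by blast
  ultimately have cond: "AE \<omega> in Q. real_cond_exp Q (F t) (Z T) \<omega> = Z t \<omega>"
    by eventually_elim (simp add: Z_def[abs_def])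
  have int_Zt: "integrable Q (Z t)"
    using integrable_cong_AE[THEN iffD1, OF _ ZtQ cond] Ft.real_cond_exp_int(1)[OF int_ZT] by simp
  show ?thesis
  proof (rule measure_eqI)
    show "sets (restr_to_subalg (Qi i) (F t)) =
        sets (density (restr_to_subalg Q (F t)) (\<lambda>\<omega>. ennreal (X i t \<omega> / X i 0 \<omega>)))"
      by (simp add: sets_restr_to_subalg[OF sub] sets_restr_to_subalg[OF subalgebra_Qi[OF t]])
    fix A assume "A \<in> sets (restr_to_subalg (Qi i) (F t))"
    then have A[measurable]: "A \<in> sets (F t)"
      by (simp add: sets_restr_to_subalg[OF subalgebra_Qi[OF t]])
    then have AQ[measurable]: "A \<in> sets Q"
      using sub by (auto simp: subalgebra_def)
    have set_nn: "(\<integral>\<^sup>+\<omega>. ennreal (Z s \<omega>) * indicator A \<omega> \<partial>Q) = ennreal (\<integral>\<omega>\<in>A. Z s \<omega> \<partial>Q)"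
      if "integrable Q (Z s)" "s \<in> I" for s
    proof -
      have "(\<integral>\<^sup>+\<omega>. ennreal (Z s \<omega>) * indicator A \<omega> \<partial>Q) = (\<integral>\<^sup>+\<omega>. ennreal (indicator A \<omega> * Z s \<omega>) \<partial>Q)"
        by (intro nn_integral_cong) (simp add: indicator_def)
      also have "\<dots> = ennreal (\<integral>\<omega>. indicator A \<omega> * Z s \<omega> \<partial>Q)"
        using that Z_nonneg integrable_mult_indicator[OF AQ that(1)]
        by (intro nn_integral_eq_integral) auto
      finally show ?thesis
        by (simp add: set_lebesgue_integral_def)
    qed
    have "emeasure (restr_to_subalg (Qi i) (F t)) A = (\<integral>\<^sup>+\<omega>. ennreal (Z T \<omega>) * indicator A \<omega> \<partial>Q)"
      by (subst emeasure_restr_to_subalg[OF subalgebra_Qi[OF t] A], subst Qi_eq)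
         (simp add: emeasure_density)
    also have "\<dots> = ennreal (\<integral>\<omega>\<in>A. Z T \<omega> \<partial>Q)"
      using int_ZT 0(3) by (rule set_nn)
    also have "(\<integral>\<omega>\<in>A. Z T \<omega> \<partial>Q) = (\<integral>\<omega>\<in>A. real_cond_exp Q (F t) (Z T) \<omega> \<partial>Q)"
      by (rule Ft.real_cond_exp_intA[OF int_ZT A])
    also have "\<dots> = (\<integral>\<omega>\<in>A. Z t \<omega> \<partial>Q)"
      unfolding set_lebesgue_integral_def
      by (rule integral_cong_AE) (use cond in auto)
    also have "ennreal \<dots> = (\<integral>\<^sup>+\<omega>. ennreal (Z t \<omega>) * indicator A \<omega> \<partial>Q)"
      using int_Zt t by (rule set_nn[symmetric])
    also have "\<dots> = (\<integral>\<^sup>+\<omega>. ennreal (Z t \<omega>) * indicator A \<omega> \<partial>restr_to_subalg Q (F t))"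
      by (rule nn_integral_subalgebra2[OF sub, symmetric]) measurable
    also have "\<dots> = emeasure (density (restr_to_subalg Q (F t)) (\<lambda>\<omega>. ennreal (Z t \<omega>))) A"
      using A measurable_in_subalg[OF sub Zt]
      by (intro emeasure_density[symmetric]) (auto simp: sets_restr_to_subalg[OF sub])
    finally show "emeasure (restr_to_subalg (Qi i) (F t)) A =
        emeasure (density (restr_to_subalg Q (F t)) (\<lambda>\<omega>. ennreal (X i t \<omega> / X i 0 \<omega>))) A"
      by (simp add: Z_def)
  qed
qed

section \<open>The path space\<close>

lemma space_path_space: "space (path_space J) = (\<Pi>\<^sub>E s\<in>J. nonneg_orthant)"
  by (simp add: path_space_def space_PiM space_restrict_space)

lemma topspace_path_topology: "topspace (path_topology J) = (\<Pi>\<^sub>E s\<in>J. nonneg_orthant)"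
  by (simp add: path_topology_def)

lemma continuous_path_tendsto:
  fixes f :: "(real \<Rightarrow> real ^ 'd) \<Rightarrow> real"
  assumes f: "continuous_map (path_topology J) euclideanreal f"
    and y: "\<And>t. y t \<in> (\<Pi>\<^sub>E s\<in>J. nonneg_orthant)" and x: "x \<in> (\<Pi>\<^sub>E s\<in>J. nonneg_orthant)"
    and lim: "\<And>s. s \<in> J \<Longrightarrow> ((\<lambda>t. y t s) \<longlongrightarrow> x s) G"
  shows "((\<lambda>t. f (y t)) \<longlongrightarrow> f x) G"
proof -
  have "limitin (path_topology J) y x G"
    unfolding path_topology_def limitin_componentwise
  proof (intro conjI ballI)
    show "x \<in> extensional J"
      using x by (auto simp: PiE_def)
    show "eventually (\<lambda>a. y a \<in> topspace (product_topology (\<lambda>_. top_of_set nonneg_orthant) J)) G"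
      using y by simp
    show "limitin (top_of_set nonneg_orthant) (\<lambda>c. y c s) (x s) G" if "s \<in> J" for s
      using that x PiE_mem[OF y that] lim[OF that] by (auto simp: limitin_subtopology)
  qed
  from continuous_map_limit[OF f this] show ?thesis
    by (simp add: o_def)
qed

lemma continuous_on_vec_max: "continuous_on A (\<lambda>v :: real ^ 'd. \<chi> i. max (v $ i) 0)"
  by (intro continuous_on_vec_lambda continuous_on_max continuous_on_const continuous_on_component continuous_on_id)

text \<open>
  The sigma-field of the path space is a product, whereas continuity refers to the product
  topology. The two are related by discretisation: replace each coordinate by a simple function of
  it that converges pointwise to the identity and takes values in the orthant. Then the discretised
  path has finitely many values, and \<open>f\<close> is the pointwise limit of simple functions by continuity.
\<close>

lemma borel_measurable_continuous_path:
  fixes f :: "(real \<Rightarrow> real ^ 'd) \<Rightarrow> real"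
  assumes J: "finite J" and f: "continuous_map (path_topology J) euclideanreal f"
  shows "f \<in> borel_measurable (path_space J)"
proof -
  let ?O = "restrict_space borel nonneg_orthant :: (real ^ 'd) measure"
  \<comment> \<open>The approximating simple functions may leave the orthant, outside of which continuity of \<open>f\<close>
    gives no information; taking positive parts brings them back.\<close>
  define pos :: "real ^ 'd \<Rightarrow> real ^ 'd" where "pos v = (\<chi> i. max (v $ i) 0)" for v
  obtain S where S: "\<And>k. simple_function ?O (S k)" "\<And>v. v \<in> space ?O \<Longrightarrow> (\<lambda>k. S k v) \<longlonglongrightarrow> v"
    using borel_measurable_implies_sequence_metric[of "\<lambda>v. v" ?O 0]
    by (auto simp: measurable_restrict_space1)
  define d where "d k v = pos (S k v)" for k v
  have d_simple: "simple_function ?O (d k)" for k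
    unfolding d_def by (rule simple_function_compose1[OF S(1)])
  have d_orthant: "d k v \<in> nonneg_orthant" for k v
    by (simp add: d_def pos_def nonneg_orthant_def)
  have d_lim: "(\<lambda>k. d k v) \<longlonglongrightarrow> v" if v: "v \<in> nonneg_orthant" for v
  proof -
    have "(\<lambda>k. pos (S k v)) \<longlonglongrightarrow> pos v"
      by (rule continuous_on_tendsto_compose[where s = UNIV, OF _ S(2)])
         (use v continuous_on_vec_max[of UNIV] in \<open>auto simp: pos_def[abs_def] space_restrict_space\<close>)
    moreover have "pos v = v"
      using v by (simp add: pos_def nonneg_orthant_def vec_eq_iff)
    ultimately show ?thesis
      by (simp add: d_def)
  qed
  define D where "D k \<omega> = (\<lambda>s\<in>J. d k (\<omega> s))" for k \<omega>
  have D_simple: "simple_function (path_space J) (D k)" for k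
    unfolding simple_function_def
  proof (intro conjI ballI)
    have "D k ` space (path_space J) \<subseteq> (\<Pi>\<^sub>E s\<in>J. d k ` space ?O)"
      by (auto simp: D_def space_path_space space_restrict_space PiE_def)
    then show "finite (D k ` space (path_space J))"
      using finite_PiE[OF J] simple_functionD(1)[OF d_simple] by (metis finite_subset)
    fix z assume "z \<in> D k ` space (path_space J)"
    then have z: "z \<in> extensional J"
      by (auto simp: D_def)
    have "D k -` {z} \<inter> space (path_space J) = {\<omega> \<in> space (path_space J). \<forall>s\<in>J. d k (\<omega> s) = z s}"
      using z by (auto simp: D_def fun_eq_iff extensional_def)
    also have "\<dots> \<in> sets (path_space J)"
    proof (rule sets.sets_Collect_finite_All[OF _ J])
      fix s assume s: "s \<in> J"
      have "(\<lambda>\<omega>. \<omega> s) \<in> measurable (path_space J) ?O"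
        unfolding path_space_def by (rule measurable_component_singleton[OF s])
      from measurable_sets[OF this simple_functionD(2)[OF d_simple[of k], of "{z s}"]]
      have "(\<lambda>\<omega>. \<omega> s) -` (d k -` {z s} \<inter> space ?O) \<inter> space (path_space J) \<in> sets (path_space J)" .
      also have "(\<lambda>\<omega>. \<omega> s) -` (d k -` {z s} \<inter> space ?O) \<inter> space (path_space J) =
          {\<omega> \<in> space (path_space J). d k (\<omega> s) = z s}"
        using s by (auto simp: space_path_space space_restrict_space)
      finally show "{\<omega> \<in> space (path_space J). d k (\<omega> s) = z s} \<in> sets (path_space J)" .
    qed
    finally show "D k -` {z} \<inter> space (path_space J) \<in> sets (path_space J)" .
  qed
  show ?thesis
  proof (rule borel_measurable_LIMSEQ_metric)
    show "(\<lambda>\<omega>. f (D k \<omega>)) \<in> borel_measurable (path_space J)" for k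
      by (rule borel_measurable_simple_function[OF simple_function_compose1[OF D_simple]])
    show "(\<lambda>k. f (D k \<omega>)) \<longlonglongrightarrow> f \<omega>" if "\<omega> \<in> space (path_space J)" for \<omega>
      using that d_orthant d_lim
      by (intro continuous_path_tendsto[OF f]) (auto simp: D_def space_path_space PiE_iff)
  qed
qed

context loeb_space
begin

text \<open>
  A bounded continuous function of finitely many coordinates of the paths converges almost
  everywhere on the Loeb space, so its integrals pass to the limit. Almost sure convergence on the
  hyperspace thus plays the part of a Skorokhod coupling.
\<close>

theorem fidi_convergent_loeb:
  fixes y :: "nat \<Rightarrow> 'a \<Rightarrow> real \<Rightarrow> real ^ 'd"
  assumes y: "\<And>n. y n \<in> measurable (M n) (path_space I)"
    and z: "z \<in> measurable (loeb U M) (path_space I)"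
    and lim: "\<And>s. s \<in> I \<Longrightarrow> AE \<omega> in loeb U M. ((\<lambda>n. y n (\<omega> n) s) \<longlongrightarrow> z \<omega> s) U"
  shows "fidi_convergent I (\<lambda>n. distr (M n) (path_space I) (y n)) (distr (loeb U M) (path_space I) z) U"
  unfolding fidi_convergent_def weakly_convergent_def
proof (intro allI impI)
  fix J :: "real set" and f :: "(real \<Rightarrow> real ^ 'd) \<Rightarrow> real"
  assume J: "finite J \<and> J \<subseteq> I"
    and f: "continuous_map (path_topology J) euclideanreal f \<and> bounded (f ` topspace (path_topology J))"
  have [measurable]: "f \<in> borel_measurable (path_space J)"
    using J f by (intro borel_measurable_continuous_path) auto
  have restr: "(\<lambda>\<omega>. restrict \<omega> J) \<in> measurable (path_space I) (path_space J)"
    unfolding path_space_def using J by (intro measurable_restrict_subset) auto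
  have integral_marginal: "(\<integral>x. f x \<partial>marginal J (distr N (path_space I) Y)) = (\<integral>x. f (restrict (Y x) J) \<partial>N)"
    and meas: "(\<lambda>x. f (restrict (Y x) J)) \<in> borel_measurable N"
    and mem: "x \<in> space N \<Longrightarrow> restrict (Y x) J \<in> space (path_space J)"
    if Y: "Y \<in> measurable N (path_space I)" for N :: "'c measure" and Y x
  proof -
    have rY: "(\<lambda>x. restrict (Y x) J) \<in> measurable N (path_space J)"
      using measurable_compose[OF Y restr] .
    show "(\<integral>x. f x \<partial>marginal J (distr N (path_space I) Y)) = (\<integral>x. f (restrict (Y x) J) \<partial>N)"
      unfolding marginal_def using rY
      by (subst distr_distr[OF restr Y], subst integral_distr) (simp_all add: o_def)
    show "(\<lambda>x. f (restrict (Y x) J)) \<in> borel_measurable N"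
      using rY by measurable
    show "x \<in> space N \<Longrightarrow> restrict (Y x) J \<in> space (path_space J)"
      using measurable_space[OF rY] .
  qed
  obtain C where C: "\<And>x. x \<in> space (path_space J) \<Longrightarrow> \<bar>f x\<bar> \<le> C"
    using f unfolding bounded_iff by (auto simp: topspace_path_topology space_path_space)
  have "AE \<omega> in loeb U M. \<forall>s\<in>J. ((\<lambda>n. y n (\<omega> n) s) \<longlongrightarrow> z \<omega> s) U"
    using J lim by (intro AE_finite_allI) auto
  then have "AE \<omega> in loeb U M. ((\<lambda>n. f (restrict (y n (\<omega> n)) J)) \<longlongrightarrow> f (restrict (z \<omega>) J)) U"
    using AE_space
  proof eventually_elim
    case (elim \<omega>)
    have 1: "restrict (y n (\<omega> n)) J \<in> (\<Pi>\<^sub>E s\<in>J. nonneg_orthant)" for n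
      unfolding space_path_space[symmetric]
      by (rule mem[OF y]) (use elim(2) in \<open>simp add: space_loeb hyperspace_def\<close>)
    have 2: "restrict (z \<omega>) J \<in> (\<Pi>\<^sub>E s\<in>J. nonneg_orthant)"
      unfolding space_path_space[symmetric] by (rule mem[OF z elim(2)])
    show ?case
      by (rule continuous_path_tendsto[OF conjunct1[OF f] 1 2]) (use elim(1) in simp)
  qed
  then show "((\<lambda>n. \<integral>x. f x \<partial>marginal J (distr (M n) (path_space I) (y n))) \<longlongrightarrow>
      (\<integral>x. f x \<partial>marginal J (distr (loeb U M) (path_space I) z))) U"
    unfolding integral_marginal[OF y] integral_marginal[OF z]
    using C mem[OF y] by (intro integral_tendsto[where C = C] meas y z) auto
qed

end

lemma subalgebra_canonical_filtration:
  "subalgebra (path_space I) (canonical_filtration I t :: (real \<Rightarrow> real ^ 'd) measure)"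
proof -
  have "(\<lambda>\<omega>. \<omega> s) -` A \<inter> space (path_space I) \<in> sets (path_space I :: (real \<Rightarrow> real ^ 'd) measure)"
    if "s \<in> I" "A \<in> sets (restrict_space borel nonneg_orthant)" for s A
    using that unfolding path_space_def
    by (intro measurable_sets[OF measurable_component_singleton]) auto
  then have "(\<Union>s\<in>I \<inter> {0..t}. {(\<lambda>\<omega>. \<omega> s) -` A \<inter> space (path_space I) |A.
      A \<in> sets (restrict_space borel nonneg_orthant)}) \<subseteq>
      sets (path_space I :: (real \<Rightarrow> real ^ 'd) measure)"
    by auto
  from sets.sigma_sets_subset[OF this] show ?thesis
    unfolding subalgebra_def canonical_filtration_def
    by (subst sets_measure_of) (auto simp: space_measure_of_conv)
qed

lemma space_canonical_filtration: "space (canonical_filtration I t) = space (path_space I)"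
  by (simp add: canonical_filtration_def space_measure_of_conv)

lemma measurable_canonical_filtration:
  fixes Y :: "'a \<Rightarrow> real \<Rightarrow> real ^ 'd::finite"
  assumes space: "\<And>\<omega>. \<omega> \<in> space M \<Longrightarrow> Y \<omega> \<in> space (path_space I)"
    and Y: "\<And>s. s \<in> I \<inter> {0..t} \<Longrightarrow> (\<lambda>\<omega>. Y \<omega> s) \<in> borel_measurable M"
  shows "Y \<in> measurable M (canonical_filtration I t)"
  unfolding canonical_filtration_def
proof (rule measurable_measure_of)
  let ?O = "restrict_space borel nonneg_orthant :: (real ^ 'd) measure"
  let ?cylinders = "\<Union>s\<in>I \<inter> {0..t}. {(\<lambda>\<omega>. \<omega> s) -` A \<inter> space (path_space I) |A. A \<in> sets ?O}"
  show "?cylinders \<subseteq> Pow (space (path_space I))"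
    by auto
  show "Y \<in> space M \<rightarrow> space (path_space I)"
    using space by auto
  fix B assume "B \<in> ?cylinders"
  then obtain s A where s: "s \<in> I \<inter> {0..t}" and A: "A \<in> sets ?O"
    and B: "B = (\<lambda>\<omega>. \<omega> s) -` A \<inter> space (path_space I)"
    by auto
  have "(\<lambda>\<omega>. Y \<omega> s) \<in> measurable M ?O"
    using s space by (intro measurable_restrict_space2 Y) (auto simp: space_path_space)
  then have "(\<lambda>\<omega>. Y \<omega> s) -` A \<inter> space M \<in> sets M"
    using A by (rule measurable_sets)
  also have "(\<lambda>\<omega>. Y \<omega> s) -` A \<inter> space M = Y -` B \<inter> space M"
    using space by (auto simp: B)
  finally show "Y -` B \<inter> space M \<in> sets M" .
qed

lemma measurable_component_canonical_filtration:
  fixes i :: "'d::finite"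
  assumes "s \<in> I" "0 \<le> s" "s \<le> t"
  shows "(\<lambda>\<omega>. \<omega> s $ i) \<in> borel_measurable (canonical_filtration I t)"
proof -
  let ?O = "restrict_space borel nonneg_orthant :: (real ^ 'd) measure"
  have "(\<lambda>\<omega>. \<omega> s) \<in> measurable (canonical_filtration I t) ?O"
  proof (rule measurableI)
    show "\<omega> s \<in> space ?O" if "\<omega> \<in> space (canonical_filtration I t)" for \<omega>
      using that assms(1) by (auto simp: space_canonical_filtration space_path_space space_restrict_space)
    show "(\<lambda>\<omega>. \<omega> s) -` A \<inter> space (canonical_filtration I t) \<in> sets (canonical_filtration I t)"
      if "A \<in> sets ?O" for A
      unfolding space_canonical_filtration unfolding canonical_filtration_def
    proof (rule in_measure_of)
      show "(\<lambda>\<omega>. \<omega> s) -` A \<inter> space (path_space I) \<in>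
          (\<Union>s\<in>I \<inter> {0..t}. {(\<lambda>\<omega>. \<omega> s) -` A \<inter> space (path_space I) |A. A \<in> sets ?O})"
        using assms that by (intro UN_I[of s] CollectI exI[of _ A]) auto
    qed auto
  qed
  moreover have "(\<lambda>v. v $ i) \<in> borel_measurable ?O"
    by (intro measurable_restrict_space1 borel_measurable_continuous_onI continuous_on_component continuous_on_id)
  ultimately show ?thesis
    by (rule measurable_compose)
qed

lemma borel_measurable_vec_lambda:
  fixes g :: "'d::finite \<Rightarrow> 'a \<Rightarrow> real"
  assumes "\<And>i. g i \<in> borel_measurable M"
  shows "(\<lambda>\<omega>. \<chi> i. g i \<omega>) \<in> borel_measurable M"
  using assms by (subst borel_measurable_euclidean_space) (auto simp: Basis_vec_def inner_axis)

lemma measurable_path_spaceI: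
  fixes Y :: "'a \<Rightarrow> real \<Rightarrow> real ^ 'd::finite"
  assumes "\<And>\<omega>. \<omega> \<in> space M \<Longrightarrow> Y \<omega> \<in> space (path_space I)"
    and "\<And>s. s \<in> I \<Longrightarrow> (\<lambda>\<omega>. Y \<omega> s) \<in> borel_measurable M"
  shows "Y \<in> measurable M (path_space I)"
  unfolding path_space_def
proof (rule measurable_PiM_single')
  show "(\<lambda>\<omega>. Y \<omega> s) \<in> measurable M (restrict_space borel nonneg_orthant)" if "s \<in> I" for s
    using assms that by (intro measurable_restrict_space2) (auto simp: space_path_space)
  show "Y \<in> space M \<rightarrow> (\<Pi>\<^sub>E i\<in>I. space (restrict_space borel nonneg_orthant))"
    using assms(1) by (auto simp: space_path_space space_restrict_space)
qed

context free_ultrafilter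
begin

section \<open>Subnets\<close>

text \<open>
  A filter becomes a net by ordering its pointed sets by reverse inclusion.
\<close>

lemma ex_subnet:
  "\<exists>(D :: (nat set \<times> nat) set) le n. subnet_of_nat D le n \<and> filterlim n U (net_filter D le)"
proof -
  define D where "D = {(A, k). eventually (\<lambda>n. n \<in> A) U \<and> k \<in> A}"
  define le where "le = (\<lambda>(A, k :: nat) (B, l :: nat). B \<subseteq> (A :: nat set))"
  have in_D: "\<exists>k. (A, k) \<in> D" if "eventually (\<lambda>n. n \<in> A) U" for A
    using that eventually_happens'[OF proper that] by (auto simp: D_def)
  have dir: "directed_set D le"
    unfolding directed_set_def
  proof (intro conjI ballI impI)
    show "D \<noteq> {}"
      using in_D[of UNIV] by auto
    fix x y assume "x \<in> D" "y \<in> D"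
    then obtain k where "(fst x \<inter> fst y, k) \<in> D"
      using in_D[of "fst x \<inter> fst y"] by (auto simp: D_def eventually_conj_iff)
    then show "\<exists>z\<in>D. le x z \<and> le y z"
      by (intro bexI[of _ "(fst x \<inter> fst y, k)"]) (auto simp: le_def)
  qed (auto simp: le_def)
  have late: "\<exists>t0\<in>D. \<forall>t\<in>D. le t0 t \<longrightarrow> R (snd t)" if R: "eventually R U" for R
  proof -
    obtain k where "({n. R n}, k) \<in> D"
      using in_D[of "{n. R n}"] R by auto
    then show ?thesis
      by (intro bexI[of _ "({n. R n}, k)"]) (auto simp: D_def le_def)
  qed
  have "subnet_of_nat D le snd"
    unfolding subnet_of_nat_def
    using dir late[OF filter_leD[OF free eventually_ge_at_top]] by simp
  moreover have "filterlim snd U (net_filter D le)"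
    unfolding filterlim_iff eventually_net_filter[OF dir] using late by blast
  ultimately show ?thesis
    by blast
qed

end

lemma fidi_convergent_compose:
  assumes conv: "fidi_convergent I \<mu> \<nu> G" and n: "filterlim n G H"
  shows "fidi_convergent I (\<lambda>\<tau>. \<mu> (n \<tau>)) \<nu> H"
  unfolding fidi_convergent_def weakly_convergent_def
proof (intro allI impI)
  fix J :: "real set" and f :: "(real \<Rightarrow> real ^ 'b) \<Rightarrow> real"
  assume "finite J \<and> J \<subseteq> I"
    "continuous_map (path_topology J) euclideanreal f \<and> bounded (f ` topspace (path_topology J))"
  then have "((\<lambda>t. \<integral>x. f x \<partial>marginal J (\<mu> t)) \<longlongrightarrow> (\<integral>x. f x \<partial>marginal J \<nu>)) G"
    using conv unfolding fidi_convergent_def weakly_convergent_def by simp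
  from filterlim_compose[OF this n]
  show "((\<lambda>\<tau>. \<integral>x. f x \<partial>marginal J (\<mu> (n \<tau>))) \<longlongrightarrow> (\<integral>x. f x \<partial>marginal J \<nu>)) H" .
qed

section \<open>The limit experiment\<close>

locale contiguous_experiments = free_ultrafilter U for U +
  fixes T :: real and I :: "real set"
    and P Q :: "nat \<Rightarrow> 'a measure"
    and F :: "nat \<Rightarrow> real \<Rightarrow> 'a measure"
    and X :: "nat \<Rightarrow> 'd::finite \<Rightarrow> real \<Rightarrow> 'a \<Rightarrow> real"
    and Qi :: "nat \<Rightarrow> 'd \<Rightarrow> 'a measure"
  assumes times: "I \<subseteq> {0..T}" "{0, T} \<subseteq> I"
    and is_experiment: "\<And>n. financial_experiment T I (P n) (F n) (X n) (Q n) (Qi n)"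
    and contiguous_Qi: "\<And>i. (\<lambda>n. Qi n i) \<lhd> Q"
begin

definition limit_ratio :: "'d \<Rightarrow> real \<Rightarrow> (nat \<Rightarrow> 'a) \<Rightarrow> ennreal" where
  "limit_ratio i s \<omega> = Liminf U (\<lambda>n. ennreal (X n i s (\<omega> n) / X n i 0 (\<omega> n)))"

text \<open>
  An infinite limit becomes zero under \<^const>\<open>enn2real\<close>, so that every limit path lies in the path
  space; at each time this changes the limit on a null set only.
\<close>

definition limit_path :: "(nat \<Rightarrow> 'a) \<Rightarrow> real \<Rightarrow> real ^ 'd" where
  "limit_path \<omega> = (\<lambda>s\<in>I. \<chi> i. enn2real (limit_ratio i s \<omega>))"

abbreviation "Qt t n \<equiv> restr_to_subalg (Q n) (F n t)"
abbreviation "Qit i t n \<equiv> restr_to_subalg (Qi n i) (F n t)"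

lemma subalgebras:
  assumes "t \<in> I"
  shows "subalgebra (Q n) (F n t)" "subalgebra (Qi n i) (F n t)"
  by (rule financial_experiment.subalgebra_Q[OF is_experiment assms]
      financial_experiment.subalgebra_Qi[OF is_experiment assms])+

lemma loeb_spaces:
  shows "loeb_space U Q" "loeb_space U (\<lambda>n. Qi n i)"
    and "t \<in> I \<Longrightarrow> loeb_space U (Qt t)" "t \<in> I \<Longrightarrow> loeb_space U (Qit i t)"
proof -
  have Q: "prob_space (Q n)" and Qi: "prob_space (Qi n i)" for n
    by (rule financial_experiment.prob_space_Q[OF is_experiment]
        financial_experiment.prob_space_Qi[OF is_experiment])+
  have *: "loeb_space U M" if "\<And>n. prob_space (M n)" for M :: "nat \<Rightarrow> 'a measure"
    by (rule loeb_space.intro[OF free_ultrafilter_axioms loeb_space_axioms.intro[OF that]])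
  show "loeb_space U Q" "loeb_space U (\<lambda>n. Qi n i)"
    by (rule *, rule Q, rule *, rule Qi)
  show "loeb_space U (Qt t)" "loeb_space U (Qit i t)" if "t \<in> I"
    by (rule *, rule prob_space_restr_to_subalg[OF subalgebras(1)[OF that] Q],
        rule *, rule prob_space_restr_to_subalg[OF subalgebras(2)[OF that] Qi])
qed

lemma ratio_measurable:
  assumes "t \<in> I" "s \<in> I" "s \<le> t"
  shows "(\<lambda>x. X n i s x / X n i 0 x) \<in> borel_measurable (Qt t n)"
proof -
  interpret E: financial_experiment T I "P n" "F n" "X n" "Q n" "Qi n"
    by (rule is_experiment)
  have meas: "(\<lambda>x. X n i s x / X n i 0 x) \<in> borel_measurable (F n s)"
    using times assms by (intro E.ratio_measurable) auto
  have sub: "subalgebra (F n t) (F n s)"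
    using E.filtration_F[of s t] E.subalgebra_F[of s] E.subalgebra_F[of t] assms by (simp add: subalgebra_def)
  show ?thesis
    by (rule measurable_in_subalg[OF subalgebras(1)[OF assms(1)] measurable_from_subalg[OF sub meas]])
qed

lemma ratio_measurable_Q:
  assumes "s \<in> I"
  shows "(\<lambda>x. X n i s x / X n i 0 x) \<in> borel_measurable (Q n)"
  using measurable_from_subalg[OF subalgebras(1)[OF assms]
      measurable_in_subalg'[OF subalgebras(1)[OF assms] ratio_measurable[OF assms assms order_refl]]] .

lemma ratio_nonneg:
  assumes "s \<in> I" "x \<in> space (Q n)"
  shows "0 \<le> X n i s x / X n i 0 x"
proof -
  interpret E: financial_experiment T I "P n" "F n" "X n" "Q n" "Qi n"
    by (rule is_experiment)
  show ?thesis
    using E.positive_X[of s x i] E.positive_X[of 0 x i] assms times by (simp add: E.space_eq)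
qed

lemma limit_ratio_measurable:
  assumes "t \<in> I" "s \<in> I" "s \<le> t"
  shows "limit_ratio i s \<in> borel_measurable (loeb U (Qt t))"
proof -
  interpret loeb_space U "Qt t"
    by (rule loeb_spaces(3)[OF assms(1)])
  have "(\<lambda>x. ennreal (X n i s x / X n i 0 x)) \<in> borel_measurable (Qt t n)" for n
    using ratio_measurable[OF assms] by simp
  then show ?thesis
    unfolding limit_ratio_def[abs_def] by (rule borel_measurable_Liminf_internal)
qed

lemma limit_path_component_measurable:
  assumes "t \<in> I" "s \<in> I" "s \<le> t"
  shows "(\<lambda>\<omega>. limit_path \<omega> s) \<in> borel_measurable (loeb U (Qt t))"
  using assms limit_ratio_measurable[OF assms]
  by (auto simp: limit_path_def intro!: borel_measurable_vec_lambda borel_measurable_enn2real)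

lemma limit_path_in_space: "limit_path \<omega> \<in> space (path_space I)"
  by (auto simp: limit_path_def space_path_space nonneg_orthant_def)

lemma limit_path_adapted:
  assumes "t \<in> I"
  shows "limit_path \<in> measurable (loeb U (Qt t)) (canonical_filtration I t)"
  using assms by (intro measurable_canonical_filtration limit_path_in_space limit_path_component_measurable) auto

lemma loeb_subalgebra:
  assumes "t \<in> I"
  shows "subalgebra (loeb U Q) (loeb U (Qt t))" "subalgebra (loeb U (\<lambda>n. Qi n i)) (loeb U (Qit i t))"
    and "restr_to_subalg (loeb U Q) (loeb U (Qt t)) = loeb U (Qt t)"
    and "restr_to_subalg (loeb U (\<lambda>n. Qi n i)) (loeb U (Qit i t)) = loeb U (Qit i t)"
  by (rule loeb_space.subalgebra_loeb[OF loeb_spaces(1) subalgebras(1)[OF assms]]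
      loeb_space.subalgebra_loeb[OF loeb_spaces(2) subalgebras(2)[OF assms]]
      loeb_space.restr_to_subalg_loeb[OF loeb_spaces(1) subalgebras(1)[OF assms]]
      loeb_space.restr_to_subalg_loeb[OF loeb_spaces(2) subalgebras(2)[OF assms]])+

lemma limit_path_measurable_Q: "limit_path \<in> measurable (loeb U Q) (path_space I)"
proof (rule measurable_path_spaceI[OF limit_path_in_space])
  fix s assume s: "s \<in> I"
  show "(\<lambda>\<omega>. limit_path \<omega> s) \<in> borel_measurable (loeb U Q)"
    by (rule measurable_from_subalg[OF loeb_subalgebra(1)[OF s] limit_path_component_measurable[OF s s order_refl]])
qed

text \<open>
  The density formula on the Loeb space at time \<open>t\<close>: the ratios at time \<open>t\<close> are the densities of the
  restrictions to \<open>F n t\<close>, and contiguity is inherited by these restrictions.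
\<close>

lemma density_at:
  assumes t: "t \<in> I"
  shows "loeb U (Qit i t) = density (loeb U (Qt t)) (limit_ratio i t)"
    and "AE \<omega> in loeb U (Qt t). limit_ratio i t \<omega> \<noteq> \<infinity> \<and>
      ((\<lambda>n. X n i t (\<omega> n) / X n i 0 (\<omega> n)) \<longlongrightarrow> enn2real (limit_ratio i t \<omega>)) U"
proof -
  interpret loeb_space U "Qt t"
    by (rule loeb_spaces(3)[OF t])
  have 1: "(\<lambda>x. X n i t x / X n i 0 x) \<in> borel_measurable (Qt t n)" for n
    using t by (intro ratio_measurable) auto
  have 2: "0 \<le> X n i t x / X n i 0 x" if "x \<in> space (Qt t n)" for n x
    using that t by (intro ratio_nonneg) (auto simp: space_restr_to_subalg)
  have 3: "Qit i t n = density (Qt t n) (\<lambda>x. ennreal (X n i t x / X n i 0 x))" for n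
    by (rule financial_experiment.restr_to_subalg_Qi[OF is_experiment times t])
  have 4: "prob_space (Qit i t n)" for n
    using loeb_space.prob[OF loeb_spaces(4)[OF t]] .
  have 5: "Qit i t \<lhd> Qt t"
    by (rule contiguous_restr_to_subalg[OF contiguous_Qi subalgebras[OF t]])
  show "loeb U (Qit i t) = density (loeb U (Qt t)) (limit_ratio i t)"
    using loeb_density[OF 1 2 3 4 5] by (simp add: limit_ratio_def[abs_def])
  show "AE \<omega> in loeb U (Qt t). limit_ratio i t \<omega> \<noteq> \<infinity> \<and>
      ((\<lambda>n. X n i t (\<omega> n) / X n i 0 (\<omega> n)) \<longlongrightarrow> enn2real (limit_ratio i t \<omega>)) U"
    using AE_tendsto_density[OF 1 2 3 4 5] by (simp add: limit_ratio_def[abs_def])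
qed

text \<open>
  Absolute continuity is read off from the density at the terminal time, before any restriction.
\<close>

lemma loeb_Qi:
  shows sets_loeb_Qi: "sets (loeb U (\<lambda>n. Qi n i)) = sets (loeb U Q)"
    and abs_cont_loeb_Qi: "absolutely_continuous (loeb U Q) (loeb U (\<lambda>n. Qi n i))"
proof -
  interpret loeb_space U Q
    by (rule loeb_spaces(1))
  have T: "T \<in> I"
    using times by auto
  have [measurable]: "(\<lambda>x. X n i T x / X n i 0 x) \<in> borel_measurable (Q n)" for n
    by (rule ratio_measurable_Q[OF T])
  have eq: "loeb U (\<lambda>n. Qi n i) =
      density (loeb U Q) (\<lambda>\<omega>. Liminf U (\<lambda>n. ennreal (X n i T (\<omega> n) / X n i 0 (\<omega> n))))"
    using ratio_nonneg[OF T] financial_experiment.density_Qi[OF is_experiment]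
      financial_experiment.prob_space_Qi[OF is_experiment] contiguous_Qi
    by (intro loeb_density) auto
  then show "sets (loeb U (\<lambda>n. Qi n i)) = sets (loeb U Q)"
    by simp
  show "absolutely_continuous (loeb U Q) (loeb U (\<lambda>n. Qi n i))"
    unfolding eq by (intro absolutely_continuousI_density borel_measurable_Liminf_internal) measurable
qed

lemma limit_path_measurable_Qi: "limit_path \<in> measurable (loeb U (\<lambda>n. Qi n i)) (path_space I)"
  using limit_path_measurable_Q measurable_cong_sets[OF sets_loeb_Qi refl] by blast

text \<open>
  Almost sure convergence under \<open>Q\<close> carries over to each \<open>Qi\<close> by absolute continuity of the Loeb
  measures.
\<close>

lemma AE_limit_path:
  assumes s: "s \<in> I"
  shows "AE \<omega> in loeb U Q. ((\<lambda>n. price_ratio_process I (X n) (\<omega> n) s) \<longlongrightarrow> limit_path \<omega> s) U"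
    and "AE \<omega> in loeb U (\<lambda>n. Qi n j). ((\<lambda>n. price_ratio_process I (X n) (\<omega> n) s) \<longlongrightarrow> limit_path \<omega> s) U"
proof -
  have "AE \<omega> in loeb U Q. limit_ratio i s \<omega> \<noteq> \<infinity> \<and>
      ((\<lambda>n. X n i s (\<omega> n) / X n i 0 (\<omega> n)) \<longlongrightarrow> enn2real (limit_ratio i s \<omega>)) U" for i
    using density_at(2)[OF s, of i]
    by (subst (asm) loeb_subalgebra(3)[OF s, symmetric]) (rule AE_restr_to_subalg[OF loeb_subalgebra(1)[OF s]])
  then have "AE \<omega> in loeb U Q. \<forall>i\<in>UNIV. limit_ratio i s \<omega> \<noteq> \<infinity> \<and>
      ((\<lambda>n. X n i s (\<omega> n) / X n i 0 (\<omega> n)) \<longlongrightarrow> enn2real (limit_ratio i s \<omega>)) U"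
    by (intro AE_finite_allI) auto
  then show Q: "AE \<omega> in loeb U Q. ((\<lambda>n. price_ratio_process I (X n) (\<omega> n) s) \<longlongrightarrow> limit_path \<omega> s) U"
    by eventually_elim (use s in \<open>auto simp: price_ratio_process_def limit_path_def intro!: vec_tendstoI\<close>)
  show "AE \<omega> in loeb U (\<lambda>n. Qi n j). ((\<lambda>n. price_ratio_process I (X n) (\<omega> n) s) \<longlongrightarrow> limit_path \<omega> s) U"
    using absolutely_continuous_AE[OF sets_loeb_Qi abs_cont_loeb_Qi Q] .
qed

lemma price_ratio_process_measurable:
  "price_ratio_process I (X n) \<in> measurable (Q n) (path_space I)"
  "price_ratio_process I (X n) \<in> measurable (Qi n i) (path_space I)"
proof -
  interpret E: financial_experiment T I "P n" "F n" "X n" "Q n" "Qi n"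
    by (rule is_experiment)
  show Q: "price_ratio_process I (X n) \<in> measurable (Q n) (path_space I)"
  proof (rule measurable_path_spaceI)
    show "price_ratio_process I (X n) \<omega> \<in> space (path_space I)" if "\<omega> \<in> space (Q n)" for \<omega>
      using ratio_nonneg that by (auto simp: price_ratio_process_def space_path_space nonneg_orthant_def)
    fix s assume s: "s \<in> I"
    have "(\<lambda>x. X n i s x / X n i 0 x) \<in> borel_measurable (Q n)" for i
      by (rule ratio_measurable_Q[OF s])
    then show "(\<lambda>\<omega>. price_ratio_process I (X n) \<omega> s) \<in> borel_measurable (Q n)"
      using s by (auto simp: price_ratio_process_def intro!: borel_measurable_vec_lambda)
  qed
  show "price_ratio_process I (X n) \<in> measurable (Qi n i) (path_space I)"
    using Q measurable_cong_sets[of "Qi n i" "Q n"] E.space_eq(3) E.sets_Q by blast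
qed

abbreviation "\<nu> \<equiv> distr (loeb U Q) (path_space I) limit_path"
abbreviation "\<nu>i i \<equiv> distr (loeb U (\<lambda>n. Qi n i)) (path_space I) limit_path"

lemma fidi_convergent_limit:
  "fidi_convergent I (\<lambda>n. distr (Q n) (path_space I) (price_ratio_process I (X n))) \<nu> U"
  "fidi_convergent I (\<lambda>n. distr (Qi n i) (path_space I) (price_ratio_process I (X n))) (\<nu>i i) U"
  by (rule loeb_space.fidi_convergent_loeb[OF loeb_spaces(1) price_ratio_process_measurable(1)
        limit_path_measurable_Q AE_limit_path(1)],
      assumption,
      rule loeb_space.fidi_convergent_loeb[OF loeb_spaces(2) price_ratio_process_measurable(2)
        limit_path_measurable_Qi AE_limit_path(2)])

text \<open>
  Transport along the limit path of the density formula at time \<open>t\<close>. As this path is adapted to the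
  lifted filtration, restricting its law to the canonical filtration is the same as taking its law
  under the restricted Loeb measure; and coordinate \<open>i\<close> of the path at time \<open>t\<close> is almost everywhere
  the standard part of the densities.
\<close>

lemma density_limit:
  assumes t: "t \<in> I"
  shows "restr_to_subalg (\<nu>i i) (canonical_filtration I t) =
    density (restr_to_subalg \<nu> (canonical_filtration I t)) (\<lambda>\<omega>. ennreal (\<omega> t $ i))"
proof -
  let ?G = "canonical_filtration I t :: (real \<Rightarrow> real ^ 'd) measure"
  have t0: "0 \<le> t"
    using t times by auto
  have Y[measurable]: "limit_path \<in> measurable (loeb U (Qt t)) ?G"
    by (rule limit_path_adapted[OF t])
  have lr[measurable]: "limit_ratio i t \<in> borel_measurable (loeb U (Qt t))"
    by (rule limit_ratio_measurable[OF t t order_refl])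
  have Yi: "limit_path \<in> measurable (loeb U (Qit i t)) ?G"
    unfolding density_at(1)[OF t] using Y by simp
  have coord[measurable]: "(\<lambda>\<omega>. ennreal (\<omega> t $ i)) \<in> borel_measurable ?G"
    using measurable_component_canonical_filtration[OF t t0 order_refl, of i] by simp
  have "AE \<omega> in loeb U (Qt t). limit_ratio i t \<omega> = ennreal (limit_path \<omega> t $ i)"
    using density_at(2)[OF t, of i]
    by eventually_elim (use t in \<open>simp add: limit_path_def less_top\<close>)
  then have dens: "density (loeb U (Qt t)) (limit_ratio i t) =
      density (loeb U (Qt t)) (\<lambda>\<omega>. ennreal (limit_path \<omega> t $ i))"
    using measurable_compose[OF Y coord] by (intro density_cong) auto
  have "restr_to_subalg (\<nu>i i) ?G = distr (restr_to_subalg (loeb U (\<lambda>n. Qi n i)) (loeb U (Qit i t))) ?G limit_path"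
    by (rule restr_to_subalg_distr[OF subalgebra_canonical_filtration loeb_subalgebra(2)[OF t] limit_path_measurable_Qi Yi])
  also have "\<dots> = distr (density (loeb U (Qt t)) (\<lambda>\<omega>. ennreal (limit_path \<omega> t $ i))) ?G limit_path"
    by (subst trans[OF loeb_subalgebra(4)[OF t] trans[OF density_at(1)[OF t] dens]]) (rule refl)
  also have "\<dots> = density (distr (loeb U (Qt t)) ?G limit_path) (\<lambda>\<omega>. ennreal (\<omega> t $ i))"
    by (rule density_distr[OF coord Y, symmetric])
  also have "distr (loeb U (Qt t)) ?G limit_path = restr_to_subalg \<nu> ?G"
    using restr_to_subalg_distr[OF subalgebra_canonical_filtration loeb_subalgebra(1)[OF t] limit_path_measurable_Q Y]
    by (simp add: loeb_subalgebra(3)[OF t])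
  finally show ?thesis .
qed

lemma standard_financial_experiment_limit: "standard_financial_experiment I \<nu> \<nu>i"
  unfolding standard_financial_experiment_def
proof (intro conjI allI ballI)
  interpret Q: loeb_space U Q
    by (rule loeb_spaces(1))
  show "prob_space \<nu>"
    by (rule Q.prob_space_distr[OF limit_path_measurable_Q])
  show "sets \<nu> = sets (path_space I)"
    by simp
  fix i
  interpret Qi: loeb_space U "\<lambda>n. Qi n i"
    by (rule loeb_spaces(2))
  show "prob_space (\<nu>i i)"
    by (rule Qi.prob_space_distr[OF limit_path_measurable_Qi])
  show "sets (\<nu>i i) = sets (path_space I)"
    by simp
  show "absolutely_continuous \<nu> (\<nu>i i)"
    unfolding absolutely_continuous_def
  proof
    fix B assume "B \<in> null_sets \<nu>"
    then have B: "B \<in> sets (path_space I)" and "limit_path -` B \<inter> space (loeb U Q) \<in> null_sets (loeb U Q)"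
      using limit_path_measurable_Q by (auto simp: null_sets_def emeasure_distr measurable_sets)
    then have "limit_path -` B \<inter> space (loeb U (\<lambda>n. Qi n i)) \<in> null_sets (loeb U (\<lambda>n. Qi n i))"
      using abs_cont_loeb_Qi[of i] sets_eq_imp_space_eq[OF sets_loeb_Qi[of i]]
      unfolding absolutely_continuous_def by auto
    then show "B \<in> null_sets (\<nu>i i)"
      using B limit_path_measurable_Qi[of i] by (auto simp: null_sets_def emeasure_distr)
  qed
  show "restr_to_subalg (\<nu>i i) (canonical_filtration I t) =
      density (restr_to_subalg \<nu> (canonical_filtration I t)) (\<lambda>\<omega>. ennreal (\<omega> t $ i))" if "t \<in> I" for t
    by (rule density_limit[OF that])
qed

end

theorem theorem5p2:
  fixes T :: real and I :: "real set"
    and P Q :: "nat \<Rightarrow> 'a measure"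
    and F :: "nat \<Rightarrow> real \<Rightarrow> 'a measure"
    and X :: "nat \<Rightarrow> 'd::finite \<Rightarrow> real \<Rightarrow> 'a \<Rightarrow> real"
    and Qi :: "nat \<Rightarrow> 'd \<Rightarrow> 'a measure"
  assumes "0 < T" and "I \<subseteq> {0..T}" and "{0, T} \<subseteq> I"
    and "\<And>n. financial_experiment T I (P n) (F n) (X n) (Q n) (Qi n)"
    and "\<And>i. contiguous (\<lambda>n. Qi n i) Q"
    and "\<And>i. contiguous Q (\<lambda>n. Qi n i)"
  shows "\<exists>(\<nu> :: (real \<Rightarrow> real ^ 'd) measure) (\<nu>i :: 'd \<Rightarrow> (real \<Rightarrow> real ^ 'd) measure).
    standard_financial_experiment I \<nu> \<nu>i \<and>
    (\<exists>(D :: (nat set \<times> nat) set) le n. subnet_of_nat D le n \<and>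
      (\<forall>i. fidi_convergent I
             (\<lambda>\<tau>. distr (Qi (n \<tau>) i) (path_space I) (price_ratio_process I (X (n \<tau>))))
             (\<nu>i i) (net_filter D le)) \<and>
      fidi_convergent I
        (\<lambda>\<tau>. distr (Q (n \<tau>)) (path_space I) (price_ratio_process I (X (n \<tau>))))
        \<nu> (net_filter D le))"
proof -
  obtain U where "free_ultrafilter U"
    using ex_free_ultrafilter ..
  then interpret contiguous_experiments U T I P Q F X Qi
    using assms by (intro contiguous_experiments.intro contiguous_experiments_axioms.intro)
  obtain D :: "(nat set \<times> nat) set" and le n
    where net: "subnet_of_nat D le n" "filterlim n U (net_filter D le)"
    using ex_subnet by blast
  show ?thesis
  proof (intro exI conjI allI)
    show "standard_financial_experiment I \<nu> \<nu>i"
      by (rule standard_financial_experiment_limit)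
    show "subnet_of_nat D le n"
      by (rule net(1))
    show "fidi_convergent I
        (\<lambda>\<tau>. distr (Qi (n \<tau>) i) (path_space I) (price_ratio_process I (X (n \<tau>)))) (\<nu>i i) (net_filter D le)" for i
      by (rule fidi_convergent_compose[OF fidi_convergent_limit(2) net(2)])
    show "fidi_convergent I
        (\<lambda>\<tau>. distr (Q (n \<tau>)) (path_space I) (price_ratio_process I (X (n \<tau>)))) \<nu> (net_filter D le)"
      by (rule fidi_convergent_compose[OF fidi_convergent_limit(1) net(2)])
  qed
qed

end
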